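(* Let $G\subset\mathbb{R}^3$ be a bounded domain with smooth boundary, and let $S:\mathbf{V}^0(G)\to\mathbf{V}^0(G)$ be the self-adjoint operator with domain $\mathbf{W}^1(G)$ acting as $S\mathbf{u}=\operatorname{rot}\mathbf{u}$. Let $\{\mathbf{q}_j^{+}\}\cup\{\mathbf{q}_j^{-}\}$ be an orthonormal basis of $\mathbf{V}^0(G)$ of eigenfunctions of $S$, $S\mathbf{q}_j^{\pm}=\pm\lambda_j\mathbf{q}_j^{\pm}$, $\lambda_j\in\Lambda$. (1) If $\lambda$ does not coincide with any eigenvalue of $S$, then $S+\lambda I$ is uniquely invertible on $\mathbf{V}^0(G)$, and its inverse is given by $$(S+\lambda I)^{-1}\mathbf{f}=\sum_{\lambda_j\in\Lambda}\bigl[(\lambda+\lambda_j)^{-1}(\mathbf{f},\mathbf{q}_j^{+})\,\mathbf{q}_j^{+}+(\lambda-\lambda_j)^{-1}(\mathbf{f},\mathbf{q}_j^{-})\,\mathbf{q}_j^{-}\bigr],\qquad \mathbf{f}\in\mathbf{V}^0(G).$$ (2) If $\lambda=\lambda_{j_0}$ for some $\lambda_{j_0}\in\Lambda$, then, for $\mathbf{f}\in\mathbf{V}^0(G)$, the equation $(S+\lambda I)\mathbf{u}=\mathbf{f}$ is solvable if and only if $$(\mathbf{f},\mathbf{q}_j^{-})=0\quad\text{for every } \mathbf{q}_j^{-}\text{ with }\lambda_j=\lambda_{j_0}.$$ The kernel of $S+\lambda_{j_0}I$ consists of all functions $\sum_{\lambda_j=\lambda_{j_0}}c_j\,\mathbf{q}_j^{-}(\mathbf{x})$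 with arbitrary constants $c_j$.
   Context: All spaces are over $\mathbb{C}$. $\mathbf{L}_2(G)$ is the space of square-integrable $\mathbb{C}^3$-valued functions with inner product $(\mathbf{u},\mathbf{v})=\int_G\mathbf{u}\cdot\overline{\mathbf{v}}\,d\mathbf{x}$. Define $\mathcal{A}(G)=\{\nabla h:\ h\in H^1(G)\}$ and let $\mathcal{B}(G)$ be its orthogonal complement in $\mathbf{L}_2(G)$ (in the generalized sense, $\mathcal{B}(G)=\{\mathbf{u}\in\mathbf{L}_2(G):\operatorname{div}\mathbf{u}=0,\ \mathbf{n}\cdot\mathbf{u}|_\Gamma=0\}$, where $\Gamma=\partial G$ and $\mathbf{n}$ is its outward unit normal). Let $$\mathcal{B}_H(G)=\{\mathbf{u}\in\mathbf{L}_2(G):\operatorname{rot}\mathbf{u}=0,\ \operatorname{div}\mathbf{u}=0,\ \mathbf{n}\cdot\mathbf{u}|_\Gamma=0\},$$ a finite-dimensional subspace of $\mathcal{B}(G)$, and let $\mathbf{V}^0(G)$ be the orthogonal complement of $\mathcal{B}_H(G)$ in $\mathcal{B}(G)$, with the $\mathbf{L}_2$ norm. Let $\mathbf{W}^1(G)=\{\mathbf{u}\in\mathbf{V}^0(G):\operatorname{rot}\mathbf{u}\in\mathbf{V}^0(G)\}$. It is known (Yoshida–Giga) that $S$ with domain $\mathbf{W}^1(G)$ is self-adjoint in $\mathbf{V}^0(G)$, has a compact inverse, and has an orthogonal basis of eigenfunctions. Standing convention: the eigenvalues of $S$ are enumerated (with multiplicity) in pairs $\pm\lambda_j$, $\lambda_j\in\Lambda$,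 $0<\lambda_j\le\lambda_{j+1}$, with normalized eigenfunctions $\mathbf{q}_j^{\pm}$, $\operatorname{rot}\mathbf{q}_j^{\pm}=\pm\lambda_j\mathbf{q}_j^{\pm}$, $\|\mathbf{q}_j^\pm\|=1$. *)

theory Defs
  imports "HOL-Analysis.Analysis"
begin

type_synonym space3 = "real ^ 3"
type_synonym field3 = "real ^ 3 \<Rightarrow> complex ^ 3"

fun Ck_on :: "nat \<Rightarrow> 'a::real_normed_vector set \<Rightarrow> ('a \<Rightarrow> 'b::real_normed_vector) \<Rightarrow> bool" where
  "Ck_on 0 U f \<longleftrightarrow> continuous_on U f"
| "Ck_on (Suc k) U f \<longleftrightarrow>
     (\<forall>x\<in>U. f differentiable (at x)) \<and> (\<forall>v. Ck_on k U (\<lambda>x. frechet_derivative f (at x) v))"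

text \<open>Used for open \<open>U\<close> only.\<close>

definition smooth_on :: "'a::real_normed_vector set \<Rightarrow> ('a \<Rightarrow> 'b::real_normed_vector) \<Rightarrow> bool" where
  "smooth_on U f \<longleftrightarrow> (\<forall>k. Ck_on k U f)"

text \<open>Boundary smoothness is expressed by local defining functions with nonvanishing differential.
  Requiring \<open>G\<close> to be the strict sublevel set puts \<open>G\<close> locally on one side of its boundary.\<close>

definition smooth_boundary :: "space3 set \<Rightarrow> bool" where
  "smooth_boundary G \<longleftrightarrow>
     (\<forall>p\<in>frontier G. \<exists>U (\<rho> :: space3 \<Rightarrow> real). open U \<and> p \<in> U \<and> smooth_on U \<rho> \<and>
        (\<forall>x\<in>U. \<exists>v. frechet_derivative \<rho> (at x) v \<noteq> 0) \<and> G \<inter> U = {x\<in>U. \<rho> x < 0})"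

definition smooth_bounded_domain :: "space3 set \<Rightarrow> bool" where
  "smooth_bounded_domain G \<longleftrightarrow>
     open G \<and> connected G \<and> G \<noteq> {} \<and> bounded G \<and> smooth_boundary G"

text \<open>Elements of the function spaces below are functions, not classes; equality in
  \<open>L\<^sub>2\<close> is equality almost everywhere on \<open>G\<close>.\<close>

definition L2 :: "space3 set \<Rightarrow> (space3 \<Rightarrow> 'b::real_normed_vector) set" where
  "L2 G = {u \<in> borel_measurable (lebesgue_on G). integrable (lebesgue_on G) (\<lambda>x. (norm (u x))\<^sup>2)}"

definition eq_L2 :: "space3 set \<Rightarrow> field3 \<Rightarrow> field3 \<Rightarrow> bool" where
  "eq_L2 G u v \<longleftrightarrow> (AE x in lebesgue_on G. u x = v x)"

definition L2_inner :: "space3 set \<Rightarrow> field3 \<Rightarrow> field3 \<Rightarrow> complex" where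
  "L2_inner G u v = (LINT x|lebesgue_on G. (\<Sum>i\<in>UNIV. u x $ i * cnj (v x $ i)))"

definition L2_norm :: "space3 set \<Rightarrow> field3 \<Rightarrow> real" where
  "L2_norm G u = sqrt (LINT x|lebesgue_on G. (norm (u x))\<^sup>2)"

text \<open>Unordered summation in \<open>L\<^sub>2(G)\<close>, the analogue of \<^const>\<open>has_sum\<close> for the norm \<open>L2_norm G\<close>.\<close>

definition L2_has_sum :: "space3 set \<Rightarrow> ('i \<Rightarrow> field3) \<Rightarrow> 'i set \<Rightarrow> field3 \<Rightarrow> bool" where
  "L2_has_sum G f I s \<longleftrightarrow>
     ((\<lambda>F. L2_norm G (\<lambda>x. (\<Sum>i\<in>F. f i x) - s x)) \<longlongrightarrow> 0) (finite_subsets_at_top I)"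

definition orthonormal_basis :: "space3 set \<Rightarrow> field3 set \<Rightarrow> ('i \<Rightarrow> field3) \<Rightarrow> bool" where
  "orthonormal_basis G V e \<longleftrightarrow>
     (\<forall>i. e i \<in> V) \<and>
     (\<forall>i j. L2_inner G (e i) (e j) = (if i = j then 1 else 0)) \<and>
     (\<forall>f\<in>V. \<forall>\<epsilon>>0. \<exists>F c. finite F \<and> L2_norm G (\<lambda>x. f x - (\<Sum>i\<in>F. c i *s e i x)) < \<epsilon>)"

definition test_function :: "space3 set \<Rightarrow> (space3 \<Rightarrow> 'b::real_normed_vector) \<Rightarrow> bool" where
  "test_function G \<phi> \<longleftrightarrow>
     smooth_on UNIV \<phi> \<and> compact (closure {x. \<phi> x \<noteq> 0}) \<and> closure {x. \<phi> x \<noteq> 0} \<subseteq> G"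

definition pd :: "3 \<Rightarrow> (space3 \<Rightarrow> complex) \<Rightarrow> space3 \<Rightarrow> complex" where
  "pd i f x = frechet_derivative f (at x) (axis i 1)"

definition classical_rot :: "field3 \<Rightarrow> field3" where
  "classical_rot \<phi> x = vector
     [pd 2 (\<lambda>y. \<phi> y $ 3) x - pd 3 (\<lambda>y. \<phi> y $ 2) x,
      pd 3 (\<lambda>y. \<phi> y $ 1) x - pd 1 (\<lambda>y. \<phi> y $ 3) x,
      pd 1 (\<lambda>y. \<phi> y $ 2) x - pd 2 (\<lambda>y. \<phi> y $ 1) x]"

definition has_weak_grad :: "space3 set \<Rightarrow> (space3 \<Rightarrow> complex) \<Rightarrow> field3 \<Rightarrow> bool" where
  "has_weak_grad G h g \<longleftrightarrow>
     (\<forall>\<phi> :: space3 \<Rightarrow> complex. test_function G \<phi> \<longrightarrow>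
        (\<forall>i. (LINT x|lebesgue_on G. h x * pd i \<phi> x) = - (LINT x|lebesgue_on G. g x $ i * \<phi> x)))"

text \<open>\<open>rot u = w\<close> in the sense of distributions. The conjugation in \<open>L2_inner\<close> is immaterial,
  since the test functions are closed under complex conjugation.\<close>

definition has_weak_rot :: "space3 set \<Rightarrow> field3 \<Rightarrow> field3 \<Rightarrow> bool" where
  "has_weak_rot G u w \<longleftrightarrow>
     (\<forall>\<phi> :: field3. test_function G \<phi> \<longrightarrow> L2_inner G u (classical_rot \<phi>) = L2_inner G w \<phi>)"

definition A_space :: "space3 set \<Rightarrow> field3 set" where
  "A_space G = {g \<in> L2 G. \<exists>h \<in> L2 G. has_weak_grad G h g}"

definition B_space :: "space3 set \<Rightarrow> field3 set" where
  "B_space G = {u \<in> L2 G. \<forall>g \<in> A_space G. L2_inner G u g = 0}"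

text \<open>The conditions \<open>div u = 0\<close>, \<open>n \<cdot> u = 0\<close> on the boundary are, in the generalized sense,
  membership in \<^const>\<open>B_space\<close>.\<close>

definition BH_space :: "space3 set \<Rightarrow> field3 set" where
  "BH_space G = {u \<in> B_space G. has_weak_rot G u (\<lambda>x. 0)}"

definition V0_space :: "space3 set \<Rightarrow> field3 set" where
  "V0_space G = {u \<in> B_space G. \<forall>v \<in> BH_space G. L2_inner G u v = 0}"

definition W1_space :: "space3 set \<Rightarrow> field3 set" where
  "W1_space G = {u \<in> V0_space G. \<exists>w \<in> V0_space G. has_weak_rot G u w}"

text \<open>The unbounded operator \<open>S\<close> is given by its graph, \<open>S u = w\<close> being \<open>(u, w) \<in> S_graph G\<close>;
  \<open>w\<close> is determined by \<open>u\<close> up to equality almost everywhere.\<close>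

definition S_graph :: "space3 set \<Rightarrow> (field3 \<times> field3) set" where
  "S_graph G = {(u, w). u \<in> W1_space G \<and> w \<in> V0_space G \<and> has_weak_rot G u w}"

definition S_shift_graph :: "space3 set \<Rightarrow> complex \<Rightarrow> (field3 \<times> field3) set" where
  "S_shift_graph G \<mu> = {(u, f). \<exists>w. (u, w) \<in> S_graph G \<and> eq_L2 G (\<lambda>x. w x + \<mu> *s u x) f}"

definition S_eigenvalue :: "space3 set \<Rightarrow> complex \<Rightarrow> bool" where
  "S_eigenvalue G \<mu> \<longleftrightarrow> (\<exists>u. (u, \<lambda>x. \<mu> *s u x) \<in> S_graph G \<and> \<not> eq_L2 G u (\<lambda>x. 0))"

end

(* The operator S is injective on V0, and its eigenvalues are bounded away from 0, so the diagonal
   operator on the eigenbasis is onto V0; an injective extension of it cannot be proper. Hence S is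
   diagonal in the basis, and (S + mu) u = f reads (mu + ev_i) (u, q_i) = (f, q_i) coefficientwise.

   Summability of the coefficients of u, and finiteness of the multiplicities, need the eigenvalues
   to be unbounded. This replaces the compactness of the inverse: were they bounded by L, then
   1 - S^2/L^2 would be a strict contraction of V0, yet it fixes the values of rot phi on a ball
   on which rot phi is constant, for every test field phi. *)

theory Submission
  imports Defs
begin

section \<open>The Hilbert space of square-integrable fields\<close>

text \<open>The weak rotation is tested only against fields compactly supported in \<open>G\<close>,
  and a basis field is in general not such a field. So the symmetry (S u, q_i) = (u, S q_i), from
  which the coefficient equations would follow at once, is not built into the graph of S; for
  general u it comes out of the comparison with the diagonal solution. With a test field in place of
  u it is immediate, and this is why the argument for unboundedness runs on smooth compactly
  supported fields. The contraction is strict because of both bounds: for \<delta> \<le> |ev| \<le>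
  L the factor 1 - ev^2/L^2 lies between 0 and 1 - \<delta>^2/L^2 < 1, so its iterates decay
  geometrically. An unbounded monotone sequence has finitely many terms below each bound. Hence the
  nonzero numbers mu + ev_i stay away from 0 and their inverses are bounded multipliers. Fields are
  functions, not classes: uniqueness and the kernel are understood up to \<open>eq_L2\<close>, and
  completeness is proved for representatives.\<close>

definition cdot :: "complex ^ 3 \<Rightarrow> complex ^ 3 \<Rightarrow> complex" where
  "cdot a b = (\<Sum>i\<in>UNIV. a $ i * cnj (b $ i))"

lemma L2_inner_cdot: "L2_inner G u v = (LINT x|lebesgue_on G. cdot (u x) (v x))"
  by (simp add: L2_inner_def cdot_def)

lemma cdot_add_left: "cdot (a + b) c = cdot a c + cdot b c"
  by (simp add: cdot_def distrib_right sum.distrib)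

lemma cdot_scale_left: "cdot (k *s a) c = k * cdot a c"
  by (simp add: cdot_def sum_distrib_left mult.assoc)

lemma cnj_cdot: "cnj (cdot a b) = cdot b a"
  by (simp add: cdot_def mult.commute)

lemma norm_vec3_sq: "(norm (a :: complex ^ 3))\<^sup>2 = (\<Sum>i\<in>UNIV. (cmod (a $ i))\<^sup>2)"
  by (simp add: norm_vec_def L2_set_def sum_nonneg)

lemma cdot_self: "cdot a a = complex_of_real ((norm a)\<^sup>2)"
  by (simp only: norm_vec3_sq cdot_def complex_norm_square of_real_sum)

lemma norm_cdot_le: "cmod (cdot a b) \<le> norm a * norm b"
proof -
  have "cmod (cdot a b) \<le> (\<Sum>i\<in>UNIV. \<bar>cmod (a $ i)\<bar> * \<bar>cmod (b $ i)\<bar>)"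
    unfolding cdot_def by (rule order_trans[OF norm_sum]) (simp add: norm_mult)
  also have "\<dots> \<le> norm a * norm b"
    unfolding norm_vec_def by (rule L2_set_mult_ineq)
  finally show ?thesis .
qed

lemma norm_vector_scalar_mult: "norm (k *s (a :: complex ^ 3)) = cmod k * norm a"
proof -
  have "(norm (k *s a))\<^sup>2 = (cmod k * norm a)\<^sup>2"
    unfolding power_mult_distrib norm_vec3_sq
    by (simp add: norm_mult power_mult_distrib sum_distrib_left)
  then show ?thesis
    by (rule power2_eq_imp_eq) auto
qed

lemma continuous_cdot: "continuous_on UNIV (\<lambda>p. cdot (fst p) (snd p))"
  unfolding cdot_def by (intro continuous_intros)

lemma bounded_linear_vector_scalar_mult: "bounded_linear (\<lambda>a :: complex ^ 3. k *s a)"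
  by (rule bounded_linear_intro[where K="cmod k"])
    (simp_all add: norm_vector_scalar_mult vec_eq_iff algebra_simps)

lemma measurable_cdot:
  assumes "u \<in> borel_measurable M" "v \<in> borel_measurable M"
  shows "(\<lambda>x. cdot (u x) (v x)) \<in> borel_measurable M"
  using borel_measurable_continuous_Pair[OF assms, of cdot] continuous_cdot by (simp add: split_def)

lemma measurable_vector_scalar_mult:
  assumes "u \<in> borel_measurable M"
  shows "(\<lambda>x. k *s (u x :: complex ^ 3)) \<in> borel_measurable M"
  using bounded_linear.continuous_on[OF bounded_linear_vector_scalar_mult continuous_on_id, of UNIV k] assms
  by (rule borel_measurable_continuous_on)

lemma measurable_norm_sq:
  fixes u :: "'a \<Rightarrow> 'b::{real_normed_vector,second_countable_topology}"
  assumes "u \<in> borel_measurable M"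
  shows "(\<lambda>x. (norm (u x))\<^sup>2) \<in> borel_measurable M"
  by (rule borel_measurable_power) (rule measurable_compose[OF assms borel_measurable_norm])

lemma L2_I: "u \<in> borel_measurable (lebesgue_on G) \<Longrightarrow> integrable (lebesgue_on G) (\<lambda>x. (norm (u x))\<^sup>2) \<Longrightarrow> u \<in> L2 G"
  by (simp add: L2_def)

lemma L2_measurable: "u \<in> L2 G \<Longrightarrow> u \<in> borel_measurable (lebesgue_on G)"
  by (simp add: L2_def)

lemma L2_integrable: "u \<in> L2 G \<Longrightarrow> integrable (lebesgue_on G) (\<lambda>x. (norm (u x))\<^sup>2)"
  by (simp add: L2_def)

lemma L2_zero: "(\<lambda>x. 0) \<in> L2 G"
  by (rule L2_I) auto

lemma L2_add:
  fixes u v :: "space3 \<Rightarrow> 'b::euclidean_space"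
  assumes "u \<in> L2 G" "v \<in> L2 G"
  shows "(\<lambda>x. u x + v x) \<in> L2 G"
proof (rule L2_I)
  show m: "(\<lambda>x. u x + v x) \<in> borel_measurable (lebesgue_on G)"
    using assms by (intro borel_measurable_add L2_measurable)
  have "integrable (lebesgue_on G) (\<lambda>x. 2 * (norm (u x))\<^sup>2 + 2 * (norm (v x))\<^sup>2)"
    using assms by (intro Bochner_Integration.integrable_add integrable_mult_right L2_integrable)
  then show "integrable (lebesgue_on G) (\<lambda>x. (norm (u x + v x))\<^sup>2)"
  proof (rule Bochner_Integration.integrable_bound)
    show "AE x in lebesgue_on G. norm ((norm (u x + v x))\<^sup>2) \<le> norm (2 * (norm (u x))\<^sup>2 + 2 * (norm (v x))\<^sup>2)"
    proof (rule AE_I2)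
      fix x
      have "(norm (u x + v x))\<^sup>2 \<le> (norm (u x) + norm (v x))\<^sup>2"
        by (intro power_mono norm_triangle_ineq) auto
      also have "\<dots> \<le> 2 * (norm (u x))\<^sup>2 + 2 * (norm (v x))\<^sup>2"
        using zero_le_power2[of "norm (u x) - norm (v x)"] by (simp add: power2_eq_square algebra_simps)
      finally show "norm ((norm (u x + v x))\<^sup>2) \<le> norm (2 * (norm (u x))\<^sup>2 + 2 * (norm (v x))\<^sup>2)"
        by simp
    qed
  qed (rule measurable_norm_sq[OF m])
qed

lemma L2_scale:
  assumes "u \<in> L2 G"
  shows "(\<lambda>x. k *s (u x :: complex ^ 3)) \<in> L2 G"
proof (rule L2_I)
  show "(\<lambda>x. k *s u x) \<in> borel_measurable (lebesgue_on G)"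
    by (rule measurable_vector_scalar_mult[OF L2_measurable[OF assms]])
  show "integrable (lebesgue_on G) (\<lambda>x. (norm (k *s u x))\<^sup>2)"
    unfolding norm_vector_scalar_mult power_mult_distrib
    by (rule integrable_mult_right[OF L2_integrable[OF assms]])
qed

lemma L2_diff:
  assumes "u \<in> L2 G" "v \<in> L2 G"
  shows "(\<lambda>x. u x - v x :: complex ^ 3) \<in> L2 G"
  using L2_add[OF assms(1) L2_scale[OF assms(2), of "-1"]] by (simp add: vector_sneg_minus1[symmetric])

lemma L2_sum:
  assumes "\<And>i. i \<in> F \<Longrightarrow> f i \<in> L2 G"
  shows "(\<lambda>x. \<Sum>i\<in>F. f i x :: complex ^ 3) \<in> L2 G"
  using assms by (induction F rule: infinite_finite_induct) (auto intro: L2_zero L2_add)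

lemma integrable_norm_mult_L2:
  fixes u :: "space3 \<Rightarrow> 'b::euclidean_space" and v :: "space3 \<Rightarrow> 'c::euclidean_space"
  assumes "u \<in> L2 G" "v \<in> L2 G"
  shows "integrable (lebesgue_on G) (\<lambda>x. norm (u x) * norm (v x))"
proof -
  have m: "(\<lambda>x. norm (u x) * norm (v x)) \<in> borel_measurable (lebesgue_on G)"
    using assms by (intro borel_measurable_times measurable_compose[OF L2_measurable borel_measurable_norm])
  have "integrable (lebesgue_on G) (\<lambda>x. (norm (u x))\<^sup>2 + (norm (v x))\<^sup>2)"
    using assms by (intro Bochner_Integration.integrable_add L2_integrable)
  then show ?thesis
  proof (rule Bochner_Integration.integrable_bound[OF _ m])
    show "AE x in lebesgue_on G. norm (norm (u x) * norm (v x)) \<le> norm ((norm (u x))\<^sup>2 + (norm (v x))\<^sup>2)"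
    proof (rule AE_I2)
      fix x
      have "0 \<le> norm (u x) * norm (v x)"
        by simp
      then show "norm (norm (u x) * norm (v x)) \<le> norm ((norm (u x))\<^sup>2 + (norm (v x))\<^sup>2)"
        using sum_squares_bound[of "norm (u x)" "norm (v x)"] unfolding mult.assoc real_norm_def
        by linarith
    qed
  qed
qed

lemma integrable_cdot:
  assumes "u \<in> L2 G" "v \<in> L2 G"
  shows "integrable (lebesgue_on G) (\<lambda>x. cdot (u x) (v x))"
  by (rule Bochner_Integration.integrable_bound[OF integrable_norm_mult_L2[OF assms]])
    (use assms in \<open>auto intro: measurable_cdot L2_measurable simp: norm_cdot_le\<close>)

lemma L2_inner_add_left:
  assumes "u \<in> L2 G" "v \<in> L2 G" "w \<in> L2 G"
  shows "L2_inner G (\<lambda>x. u x + v x) w = L2_inner G u w + L2_inner G v w"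
  using assms by (simp add: L2_inner_cdot cdot_add_left integrable_cdot)

lemma L2_inner_scale_left: "L2_inner G (\<lambda>x. k *s u x) w = k * L2_inner G u w"
  by (simp add: L2_inner_cdot cdot_scale_left)

lemma cnj_L2_inner: "cnj (L2_inner G u v) = L2_inner G v u"
  unfolding L2_inner_cdot by (subst cnj_cdot[symmetric]) (rule Bochner_Integration.integral_cnj[symmetric])

lemma L2_inner_diff_left:
  assumes "u \<in> L2 G" "v \<in> L2 G" "w \<in> L2 G"
  shows "L2_inner G (\<lambda>x. u x - v x) w = L2_inner G u w - L2_inner G v w"
  using L2_inner_add_left[OF assms(1) L2_scale[OF assms(2), of "-1"] assms(3)]
    L2_inner_scale_left[of G "-1" v w]
  by (simp add: vector_sneg_minus1[symmetric])

lemma L2_inner_add_right: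
  assumes "u \<in> L2 G" "v \<in> L2 G" "w \<in> L2 G"
  shows "L2_inner G w (\<lambda>x. u x + v x) = L2_inner G w u + L2_inner G w v"
  using arg_cong[OF L2_inner_add_left[OF assms], of cnj] by (simp add: cnj_L2_inner)

lemma L2_inner_diff_right:
  assumes "u \<in> L2 G" "v \<in> L2 G" "w \<in> L2 G"
  shows "L2_inner G w (\<lambda>x. u x - v x) = L2_inner G w u - L2_inner G w v"
  using arg_cong[OF L2_inner_diff_left[OF assms], of cnj] by (simp add: cnj_L2_inner)

lemma L2_inner_scale_right: "L2_inner G w (\<lambda>x. k *s u x) = cnj k * L2_inner G w u"
  using arg_cong[OF L2_inner_scale_left[of G k u w], of cnj] by (simp add: cnj_L2_inner)

lemma L2_inner_zero_left [simp]: "L2_inner G (\<lambda>x. 0) w = 0"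
  by (simp add: L2_inner_def)

lemma L2_inner_zero_right [simp]: "L2_inner G w (\<lambda>x. 0) = 0"
  by (simp add: L2_inner_def)

lemma L2_inner_sum_left:
  assumes "\<And>i. i \<in> F \<Longrightarrow> f i \<in> L2 G" "w \<in> L2 G"
  shows "L2_inner G (\<lambda>x. \<Sum>i\<in>F. f i x) w = (\<Sum>i\<in>F. L2_inner G (f i) w)"
  using assms
  by (induction F rule: infinite_finite_induct) (auto simp: L2_inner_add_left L2_sum)

lemma L2_inner_sum_right:
  assumes "\<And>i. i \<in> F \<Longrightarrow> f i \<in> L2 G" "w \<in> L2 G"
  shows "L2_inner G w (\<lambda>x. \<Sum>i\<in>F. f i x) = (\<Sum>i\<in>F. L2_inner G w (f i))"
  using assms
  by (induction F rule: infinite_finite_induct) (auto simp: L2_inner_add_right L2_sum)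

lemma L2_norm_nonneg [simp]: "0 \<le> L2_norm G u"
  by (simp add: L2_norm_def)

lemma L2_norm_sq: "(L2_norm G u)\<^sup>2 = (LINT x|lebesgue_on G. (norm (u x))\<^sup>2)"
  by (simp add: L2_norm_def)

lemma L2_inner_self: "L2_inner G u u = complex_of_real ((L2_norm G u)\<^sup>2)"
  by (simp only: L2_inner_cdot cdot_self L2_norm_sq integral_complex_of_real)

lemma L2_norm_minus_commute: "L2_norm G (\<lambda>x. u x - v x) = L2_norm G (\<lambda>x. v x - u x)"
  by (simp add: L2_norm_def norm_minus_commute)

lemma L2_norm_eq_0_iff:
  assumes "u \<in> L2 G"
  shows "L2_norm G u = 0 \<longleftrightarrow> eq_L2 G u (\<lambda>x. 0)"
  using integral_nonneg_eq_0_iff_AE[OF L2_integrable[OF assms]]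
  by (simp add: L2_norm_def eq_L2_def)

text \<open>A discriminant argument for A = |u|^2, B = |(u, v)|, C = |v|^2, where the form is |u - t
  (u, v) v|^2. For C > 0 the choice t = 1/C gives the claim; for C = 0 the form is affine in t and
  bounded below, which forces B = 0.\<close>

lemma quadratic_nonneg_imp_le:
  assumes "\<And>t::real. 0 \<le> A - 2 * t * B\<^sup>2 + t\<^sup>2 * B\<^sup>2 * C" and "0 \<le> (A::real)" "0 \<le> C"
  shows "B\<^sup>2 \<le> A * C"
proof (cases "C = 0")
  case True
  then have "0 \<le> A - 2 * t * B\<^sup>2" for t
    using assms(1)[of t] by simp
  \<comment> \<open>If B is nonzero, then t = (A + 1)/B^2 gives the value -A - 2, which is
    negative.\<close>
  from this[of "A / B\<^sup>2"] this[of "1 / B\<^sup>2"] have "B\<^sup>2 = 0"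
    using assms(1)[of "(A + 1) / B\<^sup>2"] True by (cases "B = 0") (auto simp: field_simps)
  then show ?thesis
    using True by simp
next
  case False
  with assms(1)[of "1 / C"] assms(3) show ?thesis
    by (simp add: field_simps power2_eq_square)
qed

lemma L2_Cauchy_Schwarz:
  assumes "u \<in> L2 G" "v \<in> L2 G"
  shows "cmod (L2_inner G u v) \<le> L2_norm G u * L2_norm G v"
proof -
  have "(cmod (L2_inner G u v))\<^sup>2 \<le> (L2_norm G u)\<^sup>2 * (L2_norm G v)\<^sup>2"
  proof (rule quadratic_nonneg_imp_le)
    fix t :: real
    \<comment> \<open>The factor (u, v) makes both cross terms equal to t |(u, v)|^2, so a real
      parameter suffices in the complex space.\<close>
    define k where "k = complex_of_real t * L2_inner G u v"
    define w where "w = (\<lambda>x. u x - k *s v x)"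
    have kv: "(\<lambda>x. k *s v x) \<in> L2 G"
      by (rule L2_scale[OF assms(2)])
    have w: "w \<in> L2 G"
      unfolding w_def by (rule L2_diff[OF assms(1) kv])
    have "L2_inner G w w = L2_inner G u u - cnj k * L2_inner G u v - k * L2_inner G v u
        + k * cnj k * L2_inner G v v"
      using w unfolding w_def
      by (simp add: L2_inner_diff_left L2_inner_diff_right L2_inner_scale_left
          L2_inner_scale_right assms kv algebra_simps)
    also have "cnj k * L2_inner G u v = complex_of_real (t * (cmod (L2_inner G u v))\<^sup>2)"
      unfolding k_def using complex_norm_square[of "L2_inner G u v"] by (simp add: mult_ac)
    also have "k * L2_inner G v u = complex_of_real (t * (cmod (L2_inner G u v))\<^sup>2)"
      unfolding k_def using complex_norm_square[of "L2_inner G u v"] by (simp add: mult_ac cnj_L2_inner)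
    also have "k * cnj k = complex_of_real (t\<^sup>2 * (cmod (L2_inner G u v))\<^sup>2)"
      unfolding k_def using complex_norm_square[of "L2_inner G u v"]
      by (simp add: mult_ac power2_eq_square)
    finally have "complex_of_real ((L2_norm G w)\<^sup>2) = complex_of_real ((L2_norm G u)\<^sup>2
        - 2 * t * (cmod (L2_inner G u v))\<^sup>2 + t\<^sup>2 * (cmod (L2_inner G u v))\<^sup>2 * (L2_norm G v)\<^sup>2)"
      unfolding L2_inner_self by simp
    then have "(L2_norm G w)\<^sup>2 = (L2_norm G u)\<^sup>2
        - 2 * t * (cmod (L2_inner G u v))\<^sup>2 + t\<^sup>2 * (cmod (L2_inner G u v))\<^sup>2 * (L2_norm G v)\<^sup>2"
      by (simp only: of_real_eq_iff)
    then show "0 \<le> (L2_norm G u)\<^sup>2 - 2 * t * (cmod (L2_inner G u v))\<^sup>2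
        + t\<^sup>2 * (cmod (L2_inner G u v))\<^sup>2 * (L2_norm G v)\<^sup>2"
      by (metis zero_le_power2)
  qed auto
  then show ?thesis
    by (metis L2_norm_nonneg mult_nonneg_nonneg power2_le_imp_le power_mult_distrib)
qed

lemma L2_norm_triangle:
  assumes "u \<in> L2 G" "v \<in> L2 G"
  shows "L2_norm G (\<lambda>x. u x + v x) \<le> L2_norm G u + L2_norm G v"
proof (rule power2_le_imp_le)
  have "complex_of_real ((L2_norm G (\<lambda>x. u x + v x))\<^sup>2)
      = L2_inner G u u + L2_inner G v v + (L2_inner G u v + cnj (L2_inner G u v))"
    using assms unfolding L2_inner_self[symmetric]
    by (simp add: L2_inner_add_left L2_inner_add_right L2_add cnj_L2_inner)
  also have "\<dots> = complex_of_real ((L2_norm G u)\<^sup>2 + (L2_norm G v)\<^sup>2 + 2 * Re (L2_inner G u v))"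
    unfolding L2_inner_self complex_add_cnj by simp
  finally have "(L2_norm G (\<lambda>x. u x + v x))\<^sup>2 = (L2_norm G u)\<^sup>2 + (L2_norm G v)\<^sup>2 + 2 * Re (L2_inner G u v)"
    by (simp only: of_real_eq_iff)
  moreover have "Re (L2_inner G u v) \<le> L2_norm G u * L2_norm G v"
    using L2_Cauchy_Schwarz[OF assms] complex_Re_le_cmod order_trans by blast
  ultimately show "(L2_norm G (\<lambda>x. u x + v x))\<^sup>2 \<le> (L2_norm G u + L2_norm G v)\<^sup>2"
    by (simp add: power2_eq_square algebra_simps)
qed auto

lemma L2_norm_triangle_diff:
  assumes "u \<in> L2 G" "v \<in> L2 G" "w \<in> L2 G"
  shows "L2_norm G (\<lambda>x. u x - w x) \<le> L2_norm G (\<lambda>x. u x - v x) + L2_norm G (\<lambda>x. v x - w x)"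
  using L2_norm_triangle[OF L2_diff[OF assms(1,2)] L2_diff[OF assms(2,3)]] by simp

lemma eq_L2_iff_norm_diff:
  assumes "u \<in> L2 G" "v \<in> L2 G"
  shows "eq_L2 G u v \<longleftrightarrow> L2_norm G (\<lambda>x. u x - v x) = 0"
  by (simp add: L2_norm_eq_0_iff[OF L2_diff[OF assms]] eq_L2_def)

lemma L2_inner_cong_left:
  assumes "eq_L2 G u v" "u \<in> L2 G" "v \<in> L2 G" "w \<in> L2 G"
  shows "L2_inner G u w = L2_inner G v w"
proof -
  have "L2_norm G (\<lambda>x. u x - v x) = 0"
    using assms eq_L2_iff_norm_diff by blast
  then have "L2_inner G (\<lambda>x. u x - v x) w = 0"
    using L2_Cauchy_Schwarz[OF L2_diff[OF assms(2,3)] assms(4)] by simp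
  then show ?thesis
    using assms by (simp add: L2_inner_diff_left)
qed

text \<open>Turns a bound of the kind that Fatou's lemma delivers into membership and a norm
  estimate at once.\<close>

lemma L2_norm_le_nn_integral:
  assumes "u \<in> borel_measurable (lebesgue_on G)" "0 \<le> C"
    and "(\<integral>\<^sup>+x. ennreal ((norm (u x))\<^sup>2) \<partial>lebesgue_on G) \<le> ennreal (C\<^sup>2)"
  shows "u \<in> L2 G" and "L2_norm G u \<le> C"
proof -
  have m: "(\<lambda>x. (norm (u x))\<^sup>2) \<in> borel_measurable (lebesgue_on G)"
    by (rule measurable_norm_sq[OF assms(1)])
  have i: "integrable (lebesgue_on G) (\<lambda>x. (norm (u x))\<^sup>2)"
    using assms(3) by (intro integrableI_nonneg[OF m]) (auto simp: less_top[symmetric] top_unique)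
  then show "u \<in> L2 G"
    using assms(1) by (rule L2_I[rotated])
  have "ennreal ((L2_norm G u)\<^sup>2) \<le> ennreal (C\<^sup>2)"
    unfolding L2_norm_sq by (subst nn_integral_eq_integral[OF i, symmetric]) (simp, rule assms(3))
  then have "(L2_norm G u)\<^sup>2 \<le> C\<^sup>2"
    by (subst (asm) ennreal_le_iff) (rule zero_le_power2)
  then show "L2_norm G u \<le> C"
    using assms(2) by (rule power2_le_imp_le)
qed

lemma nn_integral_L2:
  assumes "u \<in> L2 G"
  shows "(\<integral>\<^sup>+x. ennreal ((norm (u x))\<^sup>2) \<partial>lebesgue_on G) = ennreal ((L2_norm G u)\<^sup>2)"
  unfolding L2_norm_sq by (rule nn_integral_eq_integral[OF L2_integrable[OF assms]]) simp

text \<open>The weight 2^n is a compromise: 2^n |d_n|^2 still has summable integrals, since |d_n|^2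
  has integral at most 4^-n, and yet the weighted squares together with 2^-n dominate |d_n|
  pointwise. So the telescoping series converges absolutely almost everywhere.\<close>

lemma AE_convergent_if_fast_L2_Cauchy:
  assumes s: "\<And>n. s n \<in> L2 G"
    and c: "\<And>m n. n \<le> m \<Longrightarrow> L2_norm G (\<lambda>x. s m x - s n x) \<le> (1/2) ^ n"
  shows "AE x in lebesgue_on G. convergent (\<lambda>n. s n x :: complex ^ 3)"
proof -
  define d where "d n x = s (Suc n) x - s n x" for n x
  have d: "d n \<in> L2 G" for n
    unfolding d_def by (intro L2_diff s)
  have dm: "(\<lambda>x. ennreal (2 ^ n * (norm (d n x))\<^sup>2)) \<in> borel_measurable (lebesgue_on G)" for n
    by (intro measurable_compose[OF _ measurable_ennreal] borel_measurable_times
        borel_measurable_const measurable_norm_sq L2_measurable d)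
  have "(\<integral>\<^sup>+x. (\<Sum>n. ennreal (2 ^ n * (norm (d n x))\<^sup>2)) \<partial>lebesgue_on G)
      = (\<Sum>n. \<integral>\<^sup>+x. ennreal (2 ^ n * (norm (d n x))\<^sup>2) \<partial>lebesgue_on G)"
    by (rule nn_integral_suminf) (rule dm)
  also have "\<dots> \<le> (\<Sum>n. ennreal ((1/2) ^ n))"
  proof (rule suminf_le)
    fix n
    have "(\<integral>\<^sup>+x. ennreal (2 ^ n * (norm (d n x))\<^sup>2) \<partial>lebesgue_on G)
        = ennreal (2 ^ n) * (\<integral>\<^sup>+x. ennreal ((norm (d n x))\<^sup>2) \<partial>lebesgue_on G)"
      using L2_measurable[OF d[of n]]
      by (subst nn_integral_cmult[symmetric]) (auto simp: ennreal_mult)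
    also have "\<dots> = ennreal (2 ^ n * (L2_norm G (d n))\<^sup>2)"
      by (simp add: nn_integral_L2[OF d] ennreal_mult)
    also have "\<dots> \<le> ennreal ((1/2) ^ n)"
    proof (rule ennreal_leI)
      have "(L2_norm G (d n))\<^sup>2 \<le> ((1/2) ^ n)\<^sup>2"
        using c[of n "Suc n"] by (intro power_mono) (simp_all add: d_def[abs_def])
      then have "2 ^ n * (L2_norm G (d n))\<^sup>2 \<le> 2 ^ n * ((1/2) ^ n)\<^sup>2"
        by (intro mult_left_mono) auto
      also have "\<dots> = (1/2) ^ n"
        by (simp add: power2_eq_square power_divide)
      finally show "2 ^ n * (L2_norm G (d n))\<^sup>2 \<le> (1/2) ^ n" .
    qed
    finally show "(\<integral>\<^sup>+x. ennreal (2 ^ n * (norm (d n x))\<^sup>2) \<partial>lebesgue_on G) \<le> ennreal ((1/2) ^ n)" .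
  qed auto
  also have "\<dots> < \<infinity>"
    by (subst suminf_ennreal2) (auto intro: summable_geometric)
  finally have "AE x in lebesgue_on G. (\<Sum>n. ennreal (2 ^ n * (norm (d n x))\<^sup>2)) \<noteq> \<infinity>"
    by (intro nn_integral_PInf_AE borel_measurable_suminf_order dm) auto
  then show ?thesis
  proof (rule AE_mp, intro AE_I2 impI)
    fix x assume "(\<Sum>n. ennreal (2 ^ n * (norm (d n x))\<^sup>2)) \<noteq> \<infinity>"
    then have "summable (\<lambda>n. 2 ^ n * (norm (d n x))\<^sup>2)"
      by (intro summable_suminf_not_top) auto
    then have "summable (\<lambda>n. 2 ^ n * (norm (d n x))\<^sup>2 + (1/2) ^ n)"
      by (intro summable_add summable_geometric) auto
    then have "summable (\<lambda>n. d n x)"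
    proof (rule summable_comparison_test[rotated], intro exI allI impI)
      fix n :: nat
      \<comment> \<open>AM-GM: \<open>2 t \<le> 2\<^sup>n t\<^sup>2 + 2\<^sup>-\<^sup>n\<close>\<close>
      have "0 \<le> 2 ^ n * (norm (d n x) - (1/2) ^ n)\<^sup>2"
        by simp
      also have "\<dots> = 2 ^ n * (norm (d n x))\<^sup>2 + (1/2) ^ n - 2 * norm (d n x)"
        by (simp add: power2_eq_square algebra_simps power_divide)
      finally show "norm (d n x) \<le> 2 ^ n * (norm (d n x))\<^sup>2 + (1/2) ^ n"
        using norm_ge_zero[of "d n x"] by linarith
    qed
    then have "convergent (\<lambda>n. \<Sum>k<n. d k x)"
      by (simp add: summable_iff_convergent)
    moreover have "(\<Sum>k<n. d k x) = s n x - s 0 x" for n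
      unfolding d_def by (rule sum_lessThan_telescope)
    ultimately have "convergent (\<lambda>n. (s n x - s 0 x) + s 0 x)"
      by (intro convergent_add convergent_const) simp
    then show "convergent (\<lambda>n. s n x)"
      by simp
  qed
qed

text \<open>The limit is taken pointwise almost everywhere, and Fatou's lemma in m carries the bound
  on \<open>s m - s n\<close> over to \<open>u - s n\<close>.\<close>

lemma L2_complete:
  assumes s: "\<And>n. s n \<in> L2 G"
    and c: "\<And>m n. n \<le> m \<Longrightarrow> L2_norm G (\<lambda>x. s m x - s n x) \<le> (1/2) ^ n"
  obtains u :: field3 where "u \<in> L2 G" "\<And>n. L2_norm G (\<lambda>x. u x - s n x) \<le> (1/2) ^ n"
proof -
  \<comment> \<open>\<open>lim\<close> is total, so u is an unspecified value on the null set of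
    divergence; measurability holds all the same.\<close>
  define u where "u x = lim (\<lambda>n. s n x)" for x
  have um: "u \<in> borel_measurable (lebesgue_on G)"
    unfolding u_def by (intro borel_measurable_lim_metric L2_measurable s)
  have conv: "AE x in lebesgue_on G. (\<lambda>n. s n x) \<longlonglongrightarrow> u x"
  proof -
    have "AE x in lebesgue_on G. convergent (\<lambda>n. s n x)"
      using assms by (rule AE_convergent_if_fast_L2_Cauchy)
    then show ?thesis
      by eventually_elim (simp add: u_def convergent_LIMSEQ_iff)
  qed
  have le: "(\<integral>\<^sup>+x. ennreal ((norm (u x - s n x))\<^sup>2) \<partial>lebesgue_on G) \<le> ennreal (((1/2) ^ n)\<^sup>2)" for n
  proof -
    have "(\<integral>\<^sup>+x. ennreal ((norm (u x - s n x))\<^sup>2) \<partial>lebesgue_on G)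
        = (\<integral>\<^sup>+x. liminf (\<lambda>m. ennreal ((norm (s m x - s n x))\<^sup>2)) \<partial>lebesgue_on G)"
    proof (rule nn_integral_cong_AE, use conv in eventually_elim)
      fix x assume "(\<lambda>n. s n x) \<longlonglongrightarrow> u x"
      then have "(\<lambda>m. ennreal ((norm (s m x - s n x))\<^sup>2)) \<longlonglongrightarrow> ennreal ((norm (u x - s n x))\<^sup>2)"
        by (intro tendsto_ennrealI tendsto_intros)
      then show "ennreal ((norm (u x - s n x))\<^sup>2) = liminf (\<lambda>m. ennreal ((norm (s m x - s n x))\<^sup>2))"
        by (rule lim_imp_Liminf[OF sequentially_bot, symmetric])
    qed
    also have "\<dots> \<le> liminf (\<lambda>m. \<integral>\<^sup>+x. ennreal ((norm (s m x - s n x))\<^sup>2) \<partial>lebesgue_on G)"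
      by (intro nn_integral_liminf measurable_compose[OF _ measurable_ennreal]
          measurable_norm_sq borel_measurable_diff L2_measurable s)
    also have "\<dots> \<le> ennreal (((1/2) ^ n)\<^sup>2)"
    proof (rule Liminf_le)
      show "\<forall>\<^sub>F m in sequentially. (\<integral>\<^sup>+x. ennreal ((norm (s m x - s n x))\<^sup>2) \<partial>lebesgue_on G) \<le> ennreal (((1/2) ^ n)\<^sup>2)"
        using eventually_ge_at_top[of n]
      proof eventually_elim
        case (elim m)
        show ?case
          using c[OF elim] by (subst nn_integral_L2) (auto intro!: L2_diff s ennreal_leI power_mono)
      qed
    qed auto
    finally show ?thesis .
  qed
  have m: "(\<lambda>x. u x - s n x) \<in> borel_measurable (lebesgue_on G)" for n
    by (intro borel_measurable_diff um L2_measurable s)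
  note R = L2_norm_le_nn_integral[OF m _ le]
  have "u \<in> L2 G"
    using L2_add[OF R(1)[of 0] s[of 0]] by simp
  then show thesis
    using R(2) by (intro that) auto
qed

section \<open>Smooth functions\<close>

lemma Ck_on_continuous:
  assumes "Ck_on k UNIV f"
  shows "continuous_on UNIV f"
  using assms by (cases k) (auto intro: differentiable_imp_continuous_within simp: continuous_on_eq_continuous_within)

lemma Ck_on_SucD: "Ck_on (Suc k) UNIV f \<Longrightarrow> Ck_on k UNIV f"
proof (induction k arbitrary: f)
  case 0
  then show ?case
    using Ck_on_continuous[of "Suc 0" f] by simp
next
  case (Suc k)
  then show ?case
    by (metis Ck_on.simps(2))
qed

text \<open>Lets the derivative be given by a formula; its uniqueness replaces
  \<open>frechet_derivative\<close> by that formula.\<close>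

lemma Ck_on_SucI:
  assumes "\<And>x. (f has_derivative D x) (at x)" and "\<And>v. Ck_on k UNIV (\<lambda>x. D x v)"
  shows "Ck_on (Suc k) UNIV f"
proof -
  have "frechet_derivative f (at x) = D x" for x
    using frechet_derivative_at[OF assms(1)] by simp
  then show ?thesis
    using assms by (auto simp: differentiable_def)
qed

lemma Ck_on_has_derivative:
  assumes "Ck_on (Suc k) UNIV f"
  shows "(f has_derivative frechet_derivative f (at x)) (at x)"
  using assms by (simp add: frechet_derivative_works[symmetric])

lemma Ck_on_deriv: "Ck_on (Suc k) UNIV f \<Longrightarrow> Ck_on k UNIV (\<lambda>x. frechet_derivative f (at x) v)"
  by simp

lemma Ck_on_const: "Ck_on k UNIV (\<lambda>x. c)"
proof (induction k arbitrary: c)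
  case (Suc k)
  show ?case
    by (rule Ck_on_SucI[where D = "\<lambda>x v. 0"]) (auto intro: Suc)
qed simp

lemma Ck_on_add: "Ck_on k UNIV f \<Longrightarrow> Ck_on k UNIV g \<Longrightarrow> Ck_on k UNIV (\<lambda>x. f x + g x)"
proof (induction k arbitrary: f g)
  case (Suc k)
  show ?case
    by (rule Ck_on_SucI[OF has_derivative_add[OF Suc.prems[THEN Ck_on_has_derivative]]])
      (intro Suc.IH Ck_on_deriv Suc.prems)
qed (auto intro: continuous_on_add)

lemma Ck_on_bounded_linear: "bounded_linear L \<Longrightarrow> Ck_on k UNIV f \<Longrightarrow> Ck_on k UNIV (\<lambda>x. L (f x))"
proof (induction k arbitrary: f)
  case 0
  then show ?case
    by (simp add: bounded_linear.continuous_on)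
next
  case (Suc k)
  show ?case
    by (rule Ck_on_SucI[OF bounded_linear.has_derivative[OF Suc.prems(1) Ck_on_has_derivative[OF Suc.prems(2)]]])
      (intro Suc.IH Ck_on_deriv Suc.prems)
qed

lemma Ck_on_ident: "Ck_on k UNIV (\<lambda>x. x)"
proof (cases k)
  case (Suc n)
  show ?thesis
    unfolding Suc by (rule Ck_on_SucI[OF has_derivative_ident]) (rule Ck_on_const)
qed simp

lemma Ck_on_bounded_bilinear:
  assumes B: "bounded_bilinear B"
  shows "Ck_on k UNIV f \<Longrightarrow> Ck_on k UNIV g \<Longrightarrow> Ck_on k UNIV (\<lambda>x. B (f x) (g x))"
proof (induction k arbitrary: f g)
  case 0
  then show ?case
    by (simp add: bounded_bilinear.continuous_on[OF B])
next
  case (Suc k)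
  show ?case
    by (rule Ck_on_SucI[OF bounded_bilinear.FDERIV[OF B Suc.prems[THEN Ck_on_has_derivative]]])
      (intro Ck_on_add Suc.IH Ck_on_deriv Suc.prems Ck_on_SucD[OF Suc.prems(1)] Ck_on_SucD[OF Suc.prems(2)])
qed

text \<open>With the reals in the middle, the derivative of f at y is multiplication of its value at
  1 by a scalar. The chain rule then produces a scalar multiple of a composition with the same inner
  function g, so the induction on k closes.\<close>

lemma Ck_on_compose_real:
  fixes f :: "real \<Rightarrow> 'b::real_normed_vector" and g :: "'a::real_normed_vector \<Rightarrow> real"
  shows "Ck_on k UNIV f \<Longrightarrow> Ck_on k UNIV g \<Longrightarrow> Ck_on k UNIV (\<lambda>x. f (g x))"
proof (induction k arbitrary: f g)
  case 0
  then show ?case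
    by (auto intro: continuous_on_compose2)
next
  case (Suc k)
  have lin: "frechet_derivative f (at y) s = s *\<^sub>R frechet_derivative f (at y) 1" for y s
    using linear_cmul[OF has_derivative_linear[OF Ck_on_has_derivative[OF Suc.prems(1)]], of y s 1] by simp
  have d: "((\<lambda>x. f (g x)) has_derivative
      (\<lambda>v. frechet_derivative g (at x) v *\<^sub>R frechet_derivative f (at (g x)) 1)) (at x)" for x
    using has_derivative_compose[OF Ck_on_has_derivative[OF Suc.prems(2)] Ck_on_has_derivative[OF Suc.prems(1)]]
    by (subst lin[symmetric])
  show ?case
    by (rule Ck_on_SucI[OF d])
      (intro Ck_on_bounded_bilinear[OF bounded_bilinear_scaleR] Ck_on_deriv Suc.prems
        Suc.IH[of "\<lambda>y. frechet_derivative f (at y) 1"] Ck_on_SucD[OF Suc.prems(2)])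
qed

lemma smooth_onI: "(\<And>k. Ck_on k U f) \<Longrightarrow> smooth_on U f"
  by (simp add: smooth_on_def)

lemma smooth_on_Ck_on: "smooth_on U f \<Longrightarrow> Ck_on k U f"
  by (simp add: smooth_on_def)

lemma smooth_has_derivative:
  "smooth_on UNIV f \<Longrightarrow> (f has_derivative frechet_derivative f (at x)) (at x)"
  by (rule Ck_on_has_derivative[OF smooth_on_Ck_on])

lemma smooth_deriv: "smooth_on UNIV f \<Longrightarrow> smooth_on UNIV (\<lambda>x. frechet_derivative f (at x) v)"
  by (rule smooth_onI) (rule Ck_on_deriv[OF smooth_on_Ck_on])

lemma smooth_const: "smooth_on UNIV (\<lambda>x. c)"
  by (rule smooth_onI) (rule Ck_on_const)

lemma smooth_add: "smooth_on UNIV f \<Longrightarrow> smooth_on UNIV g \<Longrightarrow> smooth_on UNIV (\<lambda>x. f x + g x)"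
  by (auto simp: smooth_on_def intro: Ck_on_add)

lemma smooth_bounded_linear: "bounded_linear L \<Longrightarrow> smooth_on UNIV f \<Longrightarrow> smooth_on UNIV (\<lambda>x. L (f x))"
  by (auto simp: smooth_on_def intro: Ck_on_bounded_linear)

lemma smooth_bounded_bilinear:
  "bounded_bilinear B \<Longrightarrow> smooth_on UNIV f \<Longrightarrow> smooth_on UNIV g \<Longrightarrow> smooth_on UNIV (\<lambda>x. B (f x) (g x))"
  by (auto simp: smooth_on_def intro: Ck_on_bounded_bilinear)

lemma smooth_compose_real:
  fixes f :: "real \<Rightarrow> 'b::real_normed_vector" and g :: "'a::real_normed_vector \<Rightarrow> real"
  shows "smooth_on UNIV f \<Longrightarrow> smooth_on UNIV g \<Longrightarrow> smooth_on UNIV (\<lambda>x. f (g x))"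
  by (auto simp: smooth_on_def intro: Ck_on_compose_real)

lemma smooth_ident: "smooth_on UNIV (\<lambda>x. x)"
  by (intro smooth_onI Ck_on_ident)

lemma smooth_minus: "smooth_on UNIV f \<Longrightarrow> smooth_on UNIV (\<lambda>x. - f x)"
  by (rule smooth_bounded_linear[OF bounded_linear_minus[OF bounded_linear_ident]])

lemma smooth_diff: "smooth_on UNIV f \<Longrightarrow> smooth_on UNIV g \<Longrightarrow> smooth_on UNIV (\<lambda>x. f x - g x)"
  using smooth_add[OF _ smooth_minus, of f g] by simp

lemma smooth_sum: "(\<And>i. i \<in> F \<Longrightarrow> smooth_on UNIV (f i)) \<Longrightarrow> smooth_on UNIV (\<lambda>x. \<Sum>i\<in>F. f i x)"
  by (induction F rule: infinite_finite_induct) (auto intro: smooth_const smooth_add)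

lemma smooth_continuous: "smooth_on UNIV f \<Longrightarrow> continuous_on UNIV f"
  by (rule Ck_on_continuous[OF smooth_on_Ck_on])

lemma bounded_linear_axis: "bounded_linear (axis i :: complex \<Rightarrow> complex ^ 3)"
proof (rule bounded_linear_intro[where K=1])
  fix x :: complex
  have "(norm (axis i x :: complex ^ 3))\<^sup>2 = (cmod x)\<^sup>2"
    by (simp add: norm_vec3_sq axis_def if_distrib[of "\<lambda>z. (cmod z)\<^sup>2"] cong: if_cong)
  then show "norm (axis i x :: complex ^ 3) \<le> norm x * 1"
    by simp
qed (auto simp: vec_eq_iff axis_def)

lemma smooth_componentwise:
  fixes f :: "'a::real_normed_vector \<Rightarrow> complex ^ 3"
  assumes "\<And>i. smooth_on UNIV (\<lambda>x. f x $ i)"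
  shows "smooth_on UNIV f"
proof -
  have "f = (\<lambda>x. \<Sum>i\<in>UNIV. axis i (f x $ i))"
    by (auto simp: fun_eq_iff vec_eq_iff axis_def if_distrib cong: if_cong)
  moreover have "smooth_on UNIV (\<lambda>x. \<Sum>i\<in>UNIV. axis i (f x $ i) :: complex ^ 3)"
    by (intro smooth_sum smooth_bounded_linear[OF bounded_linear_axis] assms)
  ultimately show ?thesis
    by simp
qed

text \<open>For n = 0 this is the standard smooth function flat at 0. The powers of 1/t are included
  because differentiation leads from index n to the indices n + 1 and n + 2, so that the family is
  closed under it.\<close>

definition flat_exp :: "nat \<Rightarrow> real \<Rightarrow> real" where
  "flat_exp n t = (if 0 < t then exp (- (1 / t)) / t ^ n else 0)"

text \<open>Raising 1/(t m) \<le> exp (1/(t m)) to the power m gives exp (-1/t) \<le> (t m)^m. With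
  m = n + 2, division by t^n leaves t^2, which makes the difference quotient at 0 tend to 0.\<close>

lemma flat_exp_bound: "\<bar>flat_exp n t\<bar> \<le> real (n + 2) ^ (n + 2) * t\<^sup>2"
proof (cases "0 < t")
  case True
  define m where "m = n + 2"
  have m: "0 < real m"
    by (simp add: m_def)
  have "1 / (t * m) \<le> exp (1 / (t * m))"
    using exp_ge_add_one_self[of "1 / (t * m)"] by linarith
  then have "(1 / (t * m)) ^ m \<le> exp (1 / (t * m)) ^ m"
    using True m by (intro power_mono) auto
  also have "\<dots> = exp (1 / t)"
    using m by (simp add: exp_of_nat_mult[symmetric])
  finally have "exp (- (1 / t)) \<le> (t * m) ^ m"
    using True m by (simp add: exp_minus field_simps)
  then have "exp (- (1 / t)) / t ^ n \<le> (t * m) ^ m / t ^ n"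
    using True by (intro divide_right_mono) auto
  also have "\<dots> = real m ^ m * t\<^sup>2"
    using True by (simp add: m_def power_mult_distrib power_add power2_eq_square)
  finally show ?thesis
    using True by (simp add: flat_exp_def m_def)
qed (simp add: flat_exp_def)

lemma flat_exp_deriv:
  "(flat_exp n has_real_derivative - real n * flat_exp (n + 1) t + flat_exp (n + 2) t) (at t)"
proof (cases "t = 0")
  case True
  have "((\<lambda>h. (flat_exp n (0 + h) - flat_exp n 0) / h) \<longlongrightarrow> 0) (at 0)"
  proof (rule Lim_null_comparison)
    show "\<forall>\<^sub>F h in at 0. norm ((flat_exp n (0 + h) - flat_exp n 0) / h) \<le> real (n + 2) ^ (n + 2) * \<bar>h\<bar>"
    proof (rule eventually_at_filter[THEN iffD2], intro always_eventually allI impI)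
      fix h :: real assume "h \<noteq> 0"
      then show "norm ((flat_exp n (0 + h) - flat_exp n 0) / h) \<le> real (n + 2) ^ (n + 2) * \<bar>h\<bar>"
        using flat_exp_bound[of n h] by (simp add: flat_exp_def[of n 0] field_simps power2_eq_square abs_mult)
    qed
    show "((\<lambda>h. real (n + 2) ^ (n + 2) * \<bar>h\<bar>) \<longlongrightarrow> 0) (at 0)"
      by (rule tendsto_eq_intros refl | simp)+
  qed
  then show ?thesis
    using True by (simp add: DERIV_def flat_exp_def[of _ 0])
next
  case False
  show ?thesis
  proof (cases "0 < t")
    case True
    have "((\<lambda>t. exp (- (1 / t)) / t ^ n) has_real_derivative - real n * flat_exp (n + 1) t + flat_exp (n + 2) t) (at t)"
      using True
      apply (auto intro!: derivative_eq_intros simp: flat_exp_def)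
      apply (cases n)
       apply (simp_all add: field_simps power2_eq_square)
      done
    then show ?thesis
      by (rule has_field_derivative_transform_within_open[of _ _ _ "{0<..}"])
        (use True in \<open>auto simp: flat_exp_def\<close>)
  next
    case False
    have "((\<lambda>t. 0) has_real_derivative - real n * flat_exp (n + 1) t + flat_exp (n + 2) t) (at t)"
      using False by (simp add: flat_exp_def)
    then show ?thesis
      by (rule has_field_derivative_transform_within_open[of _ _ _ "{..<0}"])
        (use False \<open>t \<noteq> 0\<close> in \<open>auto simp: flat_exp_def\<close>)
  qed
qed

lemma Ck_on_flat_exp: "Ck_on k UNIV (flat_exp n)"
proof (induction k arbitrary: n)
  case 0
  show ?case
    by (auto intro!: continuous_at_imp_continuous_on DERIV_isCont[OF flat_exp_deriv])
next
  case (Suc k)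
  have "Ck_on k UNIV (\<lambda>t. (- real n * flat_exp (n + 1) t + flat_exp (n + 2) t) * v)" for v
    by (intro Ck_on_bounded_linear[OF bounded_linear_mult_left] Ck_on_add
        Ck_on_bounded_linear[OF bounded_linear_mult_right] Suc)
  then show ?case
    by (rule Ck_on_SucI[OF flat_exp_deriv[unfolded has_field_derivative_def]])
qed

text \<open>The inner cutoff vanishes on the ball of radius \<open>r\<close> and is at least \<open>1/2\<close> outside the ball of
  radius \<open>2 r\<close>, so the composition is constant on the former and zero off the latter.\<close>

definition plateau :: "'a::real_inner \<Rightarrow> real \<Rightarrow> 'a \<Rightarrow> real" where
  "plateau p r x = flat_exp 0 (1/2 - flat_exp 0 (((x - p) \<bullet> (x - p)) / r\<^sup>2 - 1))"

lemma smooth_plateau: "smooth_on UNIV (plateau p r)"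
proof -
  have f: "smooth_on UNIV (flat_exp 0)"
    by (intro smooth_onI Ck_on_flat_exp)
  have "smooth_on UNIV (\<lambda>x. ((x - p) \<bullet> (x - p)) / r\<^sup>2)"
    by (intro smooth_bounded_linear[OF bounded_linear_divide]
        smooth_bounded_bilinear[OF bounded_bilinear_inner] smooth_diff smooth_ident smooth_const)
  then have "smooth_on UNIV (\<lambda>x. flat_exp 0 (1/2 - flat_exp 0 (((x - p) \<bullet> (x - p)) / r\<^sup>2 - 1)))"
    by (intro smooth_compose_real[OF f] smooth_diff smooth_const)
  then show ?thesis
    by (simp only: plateau_def[abs_def])
qed

text \<open>The inner cutoff is 0 here, and the constant is \<open>flat_exp 0 (1/2)\<close>.\<close>

lemma plateau_inside:
  assumes "norm (x - p) < r"
  shows "plateau p r x = exp (-2)"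
proof -
  have "0 < r"
    using assms norm_ge_zero order_le_less_trans by blast
  moreover have "(norm (x - p))\<^sup>2 \<le> r\<^sup>2"
    using assms by (intro power_mono) auto
  ultimately have "flat_exp 0 (((x - p) \<bullet> (x - p)) / r\<^sup>2 - 1) = 0"
    by (simp add: flat_exp_def power2_norm_eq_inner field_simps)
  then show ?thesis
    by (simp add: plateau_def) (simp add: flat_exp_def)
qed

text \<open>For s \<ge> 2 one has exp (-1/s) \<ge> 1 - 1/s \<ge> 1/2, so the argument of the outer
  \<open>flat_exp\<close> is not positive. Outside radius 2 r the inner argument is at least 4 - 1,
  more than enough.\<close>

lemma plateau_outside:
  assumes "2 * r < norm (x - p)" "0 < r"
  shows "plateau p r x = 0"
proof -
  have "(2 * r)\<^sup>2 \<le> (norm (x - p))\<^sup>2"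
    using assms by (intro power_mono) auto
  moreover have "(2 * r)\<^sup>2 = 3 * r\<^sup>2 + r\<^sup>2"
    by (simp add: power_mult_distrib)
  ultimately have "3 * r\<^sup>2 \<le> (norm (x - p))\<^sup>2"
    using zero_le_power2[of r] by linarith
  then have s: "2 \<le> ((x - p) \<bullet> (x - p)) / r\<^sup>2 - 1" (is "2 \<le> ?s")
    using assms(2) by (simp add: power2_norm_eq_inner field_simps)
  have inverse_le: "1 / 2 \<le> 1 + - (1 / a)" if "2 \<le> a" for a :: real
    using that by (simp add: field_simps)
  have "1 / 2 \<le> 1 + - (1 / ?s)"
    using inverse_le[OF s] .
  also have "\<dots> \<le> flat_exp 0 ?s"
    using s exp_ge_add_one_self[of "- (1 / ?s)"] by (simp add: flat_exp_def)
  finally show ?thesis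
    by (simp add: plateau_def) (simp add: flat_exp_def)
qed

section \<open>Symmetry of second derivatives\<close>

lemma has_real_derivative_along_line:
  fixes F :: "'a::real_normed_vector \<Rightarrow> real"
  assumes "(F has_derivative D) (at (x + s *\<^sub>R v))"
  shows "((\<lambda>t. F (x + t *\<^sub>R v)) has_real_derivative D v) (at s)"
proof -
  have "((\<lambda>t. x + t *\<^sub>R v) has_derivative (\<lambda>t. t *\<^sub>R v)) (at s)"
    by (auto intro!: derivative_eq_intros)
  from has_derivative_compose[OF this assms]
  have "((\<lambda>t. F (x + t *\<^sub>R v)) has_derivative (\<lambda>t. D (t *\<^sub>R v))) (at s)" .
  moreover have "(\<lambda>t. D (t *\<^sub>R v)) = (*) (D v)"
    using linear_cmul[OF has_derivative_linear[OF assms]] by (auto simp: fun_eq_iff)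
  ultimately show ?thesis
    by (simp add: has_field_derivative_def)
qed

text \<open>Two applications of the mean value theorem, first along v and then along w. The
  left-hand side is symmetric in v and w while the right-hand side names an order of
  differentiation; this asymmetry is what yields Schwarz's theorem.\<close>

lemma second_difference_mean_value:
  fixes F :: "'a::real_normed_vector \<Rightarrow> real"
  assumes F: "smooth_on UNIV F" and h: "0 < h"
  obtains p where "norm (p - x) \<le> h * (norm v + norm w)"
    and "F (x + h *\<^sub>R v + h *\<^sub>R w) - F (x + h *\<^sub>R v) - F (x + h *\<^sub>R w) + F x
      = h\<^sup>2 * frechet_derivative (\<lambda>y. frechet_derivative F (at y) v) (at p) w"
proof -
  define D where "D y = frechet_derivative F (at y) v" for y
  have D: "smooth_on UNIV D"
    unfolding D_def[abs_def] by (rule smooth_deriv[OF F])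
  \<comment> \<open>The mean value theorem for the increment s \<mapsto> F (x + h w + s v) - F (x +
    s v).\<close>
  have "\<exists>s>0. s < h \<and> (F (x + h *\<^sub>R w + h *\<^sub>R v) - F (x + h *\<^sub>R v)) - (F (x + h *\<^sub>R w + 0 *\<^sub>R v) - F (x + 0 *\<^sub>R v))
      = (h - 0) * (D (x + h *\<^sub>R w + s *\<^sub>R v) - D (x + s *\<^sub>R v))"
    unfolding D_def
    by (rule MVT2[OF h]) (intro DERIV_diff has_real_derivative_along_line smooth_has_derivative[OF F])
  then obtain s where s: "0 < s" "s < h"
    and 1: "F (x + h *\<^sub>R v + h *\<^sub>R w) - F (x + h *\<^sub>R v) - F (x + h *\<^sub>R w) + F x
      = h * (D (x + s *\<^sub>R v + h *\<^sub>R w) - D (x + s *\<^sub>R v + 0 *\<^sub>R w))"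
    by (auto simp: algebra_simps)
  have "\<exists>t>0. t < h \<and> D (x + s *\<^sub>R v + h *\<^sub>R w) - D (x + s *\<^sub>R v + 0 *\<^sub>R w)
      = (h - 0) * frechet_derivative D (at (x + s *\<^sub>R v + t *\<^sub>R w)) w"
    by (rule MVT2[OF h]) (intro has_real_derivative_along_line smooth_has_derivative[OF D])
  then obtain t where t: "0 < t" "t < h"
    and 2: "D (x + s *\<^sub>R v + h *\<^sub>R w) - D (x + s *\<^sub>R v + 0 *\<^sub>R w)
      = h * frechet_derivative D (at (x + s *\<^sub>R v + t *\<^sub>R w)) w"
    by auto
  show thesis
  proof (rule that)
    have "norm (s *\<^sub>R v + t *\<^sub>R w) \<le> s * norm v + t * norm w"
      using s t by (intro order_trans[OF norm_triangle_ineq]) auto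
    also have "\<dots> \<le> h * norm v + h * norm w"
      using s t by (intro add_mono mult_right_mono) auto
    finally show "norm ((x + s *\<^sub>R v + t *\<^sub>R w) - x) \<le> h * (norm v + norm w)"
      by (simp add: algebra_simps)
    show "F (x + h *\<^sub>R v + h *\<^sub>R w) - F (x + h *\<^sub>R v) - F (x + h *\<^sub>R w) + F x
      = h\<^sup>2 * frechet_derivative (\<lambda>y. frechet_derivative F (at y) v) (at (x + s *\<^sub>R v + t *\<^sub>R w)) w"
      using 1 2 by (simp add: D_def[abs_def] power2_eq_square)
  qed
qed

text \<open>The two orders of differentiation agree at points p and q that both tend to x as the
  step h shrinks; continuity of the second derivatives finishes.\<close>

lemma mixed_derivatives_commute_real:
  fixes F :: "'a::real_normed_vector \<Rightarrow> real"
  assumes F: "smooth_on UNIV F"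
  shows "frechet_derivative (\<lambda>y. frechet_derivative F (at y) v) (at x) w
    = frechet_derivative (\<lambda>y. frechet_derivative F (at y) w) (at x) v"
proof -
  define A where "A v w p = frechet_derivative (\<lambda>y. frechet_derivative F (at y) v) (at p) w" for v w p
  have cont: "continuous_on UNIV (A v w)" for v w
    unfolding A_def[abs_def] by (intro smooth_continuous smooth_deriv F)
  define h where "h n = inverse (real (Suc n))" for n
  have h: "0 < h n" for n
    by (simp add: h_def)
  have h0: "h \<longlonglongrightarrow> 0"
    unfolding h_def[abs_def] by (rule LIMSEQ_inverse_real_of_nat)
  have lim: "(\<lambda>n. A v w (p n)) \<longlonglongrightarrow> A v w x"
    if "\<And>n. norm (p n - x) \<le> h n * (norm v + norm w)" for p v w
  proof -
    have "(\<lambda>n. p n - x) \<longlonglongrightarrow> 0"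
      by (rule Lim_null_comparison[OF always_eventually[OF allI[OF that]]])
        (rule tendsto_mult_left_zero[OF h0])
    then have "p \<longlonglongrightarrow> x"
      by (simp add: LIM_zero_iff)
    then show ?thesis
      using cont[of v w] by (simp add: continuous_on_eq_continuous_at isCont_tendsto_compose)
  qed
  have "\<exists>p q. norm (p - x) \<le> h n * (norm v + norm w) \<and> norm (q - x) \<le> h n * (norm w + norm v)
      \<and> A v w p = A w v q" for n
  proof -
    obtain p where p: "norm (p - x) \<le> h n * (norm v + norm w)"
      "F (x + h n *\<^sub>R v + h n *\<^sub>R w) - F (x + h n *\<^sub>R v) - F (x + h n *\<^sub>R w) + F x = (h n)\<^sup>2 * A v w p"
      unfolding A_def using second_difference_mean_value[OF F h] .
    obtain q where q: "norm (q - x) \<le> h n * (norm w + norm v)"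
      "F (x + h n *\<^sub>R w + h n *\<^sub>R v) - F (x + h n *\<^sub>R w) - F (x + h n *\<^sub>R v) + F x = (h n)\<^sup>2 * A w v q"
      unfolding A_def using second_difference_mean_value[OF F h] .
    have "(h n)\<^sup>2 * A v w p = (h n)\<^sup>2 * A w v q"
      using p(2) q(2) by (simp add: algebra_simps)
    then show ?thesis
      using p(1) q(1) h[of n] by auto
  qed
  then obtain p q where "\<And>n. norm (p n - x) \<le> h n * (norm v + norm w)"
    "\<And>n. norm (q n - x) \<le> h n * (norm w + norm v)" "\<And>n. A v w (p n) = A w v (q n)"
    by metis
  then have "A v w x = A w v x"
    using lim[of p v w] lim[of q w v] LIMSEQ_unique by auto
  then show ?thesis
    by (simp add: A_def)
qed

lemma frechet_derivative_bounded_linear: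
  assumes "bounded_linear L" "f differentiable (at x)"
  shows "frechet_derivative (\<lambda>y. L (f y)) (at x) v = L (frechet_derivative f (at x) v)"
  using frechet_derivative_at[OF bounded_linear.has_derivative[OF assms(1)
      frechet_derivative_works[THEN iffD1, OF assms(2)]]] by metis

lemma smooth_differentiable: "smooth_on UNIV f \<Longrightarrow> f differentiable (at x)"
  using smooth_has_derivative differentiable_def by blast

text \<open>The mean value theorem is about real values, so real and imaginary parts are treated
  apart; both are bounded linear and pass through derivatives.\<close>

lemma mixed_derivatives_commute:
  fixes f :: "'a::real_normed_vector \<Rightarrow> complex"
  assumes f: "smooth_on UNIV f"
  shows "frechet_derivative (\<lambda>y. frechet_derivative f (at y) v) (at x) w
    = frechet_derivative (\<lambda>y. frechet_derivative f (at y) w) (at x) v"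
proof -
  have *: "L (frechet_derivative (\<lambda>y. frechet_derivative f (at y) v) (at x) w)
    = frechet_derivative (\<lambda>y. frechet_derivative (\<lambda>z. L (f z)) (at y) v) (at x) w"
    if L: "bounded_linear L" for L :: "complex \<Rightarrow> real" and v w
    by (simp add: frechet_derivative_bounded_linear[OF L] smooth_differentiable smooth_deriv f)
  have "L (frechet_derivative (\<lambda>y. frechet_derivative f (at y) v) (at x) w)
    = L (frechet_derivative (\<lambda>y. frechet_derivative f (at y) w) (at x) v)"
    if L: "bounded_linear L" for L :: "complex \<Rightarrow> real"
    unfolding *[OF L] by (rule mixed_derivatives_commute_real[OF smooth_bounded_linear[OF L f]])
  from this[OF bounded_linear_Re] this[OF bounded_linear_Im] show ?thesis
    by (rule complex_eqI)
qed

section \<open>Rotations of test fields\<close>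

lemma smooth_component: "smooth_on UNIV \<phi> \<Longrightarrow> smooth_on UNIV (\<lambda>x. (\<phi> x :: complex ^ 3) $ i)"
  by (rule smooth_bounded_linear[OF bounded_linear_vec_nth])

lemma smooth_pd: "smooth_on UNIV f \<Longrightarrow> smooth_on UNIV (\<lambda>x. pd i f x)"
  unfolding pd_def by (rule smooth_deriv)

lemma pd_component:
  assumes "smooth_on UNIV \<phi>"
  shows "pd i (\<lambda>y. \<phi> y $ j) x = frechet_derivative \<phi> (at x) (axis i 1) $ j"
  unfolding pd_def
  by (rule frechet_derivative_bounded_linear[OF bounded_linear_vec_nth smooth_differentiable[OF assms]])

lemma pd_diff:
  assumes "smooth_on UNIV f" "smooth_on UNIV g"
  shows "pd i (\<lambda>y. f y - g y) x = pd i f x - pd i g x"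
  unfolding pd_def
  using frechet_derivative_at[OF has_derivative_diff[OF assms[THEN smooth_has_derivative]]] by metis

lemma pd_bounded_linear:
  assumes "bounded_linear L" "smooth_on UNIV f"
  shows "pd i (\<lambda>y. L (f y)) x = L (pd i f x)"
  unfolding pd_def
  by (rule frechet_derivative_bounded_linear[OF assms(1) smooth_differentiable[OF assms(2)]])

lemma pd_commute: "smooth_on UNIV f \<Longrightarrow> pd i (\<lambda>y. pd j f y) x = pd j (\<lambda>y. pd i f y) x"
  unfolding pd_def by (rule mixed_derivatives_commute)

lemma classical_rot_nth:
  "classical_rot \<phi> x $ 1 = pd 2 (\<lambda>y. \<phi> y $ 3) x - pd 3 (\<lambda>y. \<phi> y $ 2) x"
  "classical_rot \<phi> x $ 2 = pd 3 (\<lambda>y. \<phi> y $ 1) x - pd 1 (\<lambda>y. \<phi> y $ 3) x"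
  "classical_rot \<phi> x $ 3 = pd 1 (\<lambda>y. \<phi> y $ 2) x - pd 2 (\<lambda>y. \<phi> y $ 1) x"
  by (simp_all add: classical_rot_def)

lemma smooth_classical_rot:
  assumes "smooth_on UNIV \<phi>"
  shows "smooth_on UNIV (classical_rot \<phi>)"
proof (rule smooth_componentwise)
  fix i :: 3
  have d: "smooth_on UNIV (\<lambda>x. pd i (\<lambda>y. \<phi> y $ j) x)" for i j
    by (rule smooth_pd[OF smooth_component[OF assms]])
  show "smooth_on UNIV (\<lambda>x. classical_rot \<phi> x $ i)"
    using exhaust_3[of i] by (auto simp: classical_rot_nth intro!: smooth_diff d)
qed

text \<open>Shaped for the operator 1 - k rot rot, which thereby commutes with the rotation.\<close>

lemma classical_rot_diff_scale:
  assumes "smooth_on UNIV \<phi>" "smooth_on UNIV \<psi>"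
  shows "classical_rot (\<lambda>x. \<phi> x - k *s \<psi> x) x = classical_rot \<phi> x - k *s classical_rot \<psi> x"
proof -
  have "pd i (\<lambda>y. (\<phi> y - k *s \<psi> y) $ j) x = pd i (\<lambda>y. \<phi> y $ j) x - k * pd i (\<lambda>y. \<psi> y $ j) x" for i j
    using pd_diff[OF smooth_component[OF assms(1), of j]
        smooth_bounded_linear[OF bounded_linear_mult_right[of k] smooth_component[OF assms(2), of j]], of i x]
      pd_bounded_linear[OF bounded_linear_mult_right[of k] smooth_component[OF assms(2), of j], of i x]
    by simp
  then show ?thesis
    by (simp add: vec_eq_iff forall_3 classical_rot_nth algebra_simps)
qed

text \<open>The six mixed derivatives cancel in pairs. The instances of \<open>pd_commute\<close>
  are oriented so as to sort the indices, which keeps rewriting terminating.\<close>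

lemma divergence_classical_rot:
  assumes "smooth_on UNIV \<phi>"
  shows "(\<Sum>i\<in>UNIV. pd i (\<lambda>y. classical_rot \<phi> y $ i) x) = 0"
  by (simp add: sum_3 classical_rot_nth pd_diff smooth_pd smooth_component assms
      pd_commute[OF smooth_component[OF assms], of 2 1] pd_commute[OF smooth_component[OF assms], of 3 1]
      pd_commute[OF smooth_component[OF assms], of 3 2])

lemma frechet_derivative_locally_const:
  assumes "open U" "x \<in> U" "\<And>y. y \<in> U \<Longrightarrow> f y = c"
  shows "frechet_derivative f (at x) v = 0"
proof -
  have "(f has_derivative (\<lambda>v. 0)) (at x)"
    by (rule has_derivative_transform_within_open[OF has_derivative_const assms(1,2)])
      (simp add: assms(3))
  then show ?thesis
    using frechet_derivative_at by metis
qed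

text \<open>Used with c = 0 to control supports, and with general c to show that iterated rotations
  leave the plateau untouched.\<close>

lemma classical_rot_locally_const:
  assumes "open U" "x \<in> U" "\<And>y. y \<in> U \<Longrightarrow> \<phi> y = c"
  shows "classical_rot \<phi> x = 0"
proof -
  have "pd i (\<lambda>y. \<phi> y $ j) x = 0" for i j
    unfolding pd_def by (rule frechet_derivative_locally_const[OF assms(1,2)]) (simp add: assms(3))
  then show ?thesis
    by (simp add: vec_eq_iff forall_3 classical_rot_nth)
qed

section \<open>Test fields, and the place of their rotations in the function spaces\<close>

lemma test_function_smooth: "test_function G \<phi> \<Longrightarrow> smooth_on UNIV \<phi>"
  by (simp add: test_function_def)

lemma test_function_subset:
  assumes "test_function G \<phi>" "smooth_on UNIV \<psi>" "{x. \<psi> x \<noteq> 0} \<subseteq> closure {x. \<phi> x \<noteq> 0}"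
  shows "test_function G \<psi>"
proof -
  have "closure {x. \<psi> x \<noteq> 0} \<subseteq> closure {x. \<phi> x \<noteq> 0}"
    by (rule closure_minimal[OF assms(3) closed_closure])
  then show ?thesis
    using assms(1,2) compact_Int_closed[of "closure {x. \<phi> x \<noteq> 0}" "closure {x. \<psi> x \<noteq> 0}"]
    by (auto simp: test_function_def Int_absorb1)
qed

lemma test_function_bounded_linear:
  assumes "test_function G \<phi>" "bounded_linear L"
  shows "test_function G (\<lambda>x. L (\<phi> x))"
proof (rule test_function_subset[OF assms(1)])
  show "smooth_on UNIV (\<lambda>x. L (\<phi> x))"
    by (rule smooth_bounded_linear[OF assms(2) test_function_smooth[OF assms(1)]])
  have "{x. L (\<phi> x) \<noteq> 0} \<subseteq> {x. \<phi> x \<noteq> 0}"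
    using linear_0[OF bounded_linear.linear[OF assms(2)]] by auto
  then show "{x. L (\<phi> x) \<noteq> 0} \<subseteq> closure {x. \<phi> x \<noteq> 0}"
    using closure_subset by blast
qed

lemma test_function_deriv:
  assumes "test_function G \<phi>"
  shows "test_function G (\<lambda>x. frechet_derivative \<phi> (at x) v)"
proof (rule test_function_subset[OF assms smooth_deriv[OF test_function_smooth[OF assms]]])
  show "{x. frechet_derivative \<phi> (at x) v \<noteq> 0} \<subseteq> closure {x. \<phi> x \<noteq> 0}"
  proof (rule subsetI, rule ccontr)
    fix x assume x: "x \<in> {x. frechet_derivative \<phi> (at x) v \<noteq> 0}" "x \<notin> closure {x. \<phi> x \<noteq> 0}"
    have "frechet_derivative \<phi> (at x) v = 0"
    proof (rule frechet_derivative_locally_const)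
      show "open (- closure {x. \<phi> x \<noteq> 0})"
        by (rule open_Compl[OF closed_closure])
      show "\<phi> y = 0" if "y \<in> - closure {x. \<phi> x \<noteq> 0}" for y
        using that closure_subset[of "{x. \<phi> x \<noteq> 0}"] by auto
    qed (use x in simp)
    then show False
      using x by simp
  qed
qed

lemma test_function_diff:
  assumes "test_function G \<phi>" "test_function G \<psi>"
  shows "test_function G (\<lambda>x. \<phi> x - \<psi> x)"
proof -
  have "closure {x. \<phi> x - \<psi> x \<noteq> 0} \<subseteq> closure ({x. \<phi> x \<noteq> 0} \<union> {x. \<psi> x \<noteq> 0})"
    by (intro closure_mono) auto
  then have sub: "closure {x. \<phi> x - \<psi> x \<noteq> 0} \<subseteq> closure {x. \<phi> x \<noteq> 0} \<union> closure {x. \<psi> x \<noteq> 0}"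
    by (simp only: closure_Un)
  have "compact (closure {x. \<phi> x \<noteq> 0} \<union> closure {x. \<psi> x \<noteq> 0})"
    using assms by (intro compact_Un) (auto simp: test_function_def)
  from compact_Int_closed[OF this closed_closure[of "{x. \<phi> x - \<psi> x \<noteq> 0}"]]
  have "compact (closure {x. \<phi> x - \<psi> x \<noteq> 0})"
    using sub by (simp add: Int_absorb1)
  then show ?thesis
    using assms sub by (auto simp: test_function_def intro!: smooth_diff)
qed

lemma test_function_classical_rot:
  assumes "test_function G \<phi>"
  shows "test_function G (classical_rot \<phi>)"
proof (rule test_function_subset[OF assms smooth_classical_rot[OF test_function_smooth[OF assms]]])
  show "{x. classical_rot \<phi> x \<noteq> 0} \<subseteq> closure {x. \<phi> x \<noteq> 0}"
  proof (rule subsetI, rule ccontr)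
    fix x assume x: "x \<in> {x. classical_rot \<phi> x \<noteq> 0}" "x \<notin> closure {x. \<phi> x \<noteq> 0}"
    have "classical_rot \<phi> x = 0"
    proof (rule classical_rot_locally_const)
      show "open (- closure {x. \<phi> x \<noteq> 0})"
        by (rule open_Compl[OF closed_closure])
      show "\<phi> y = 0" if "y \<in> - closure {x. \<phi> x \<noteq> 0}" for y
        using that closure_subset[of "{x. \<phi> x \<noteq> 0}"] by auto
    qed (use x in simp)
    then show False
      using x by simp
  qed
qed

lemma test_function_L2:
  fixes \<phi> :: "space3 \<Rightarrow> 'b::euclidean_space"
  assumes "open G" "bounded G" "test_function G \<phi>"
  shows "\<phi> \<in> L2 G"
proof (rule L2_I)
  have c: "continuous_on UNIV \<phi>"
    by (rule smooth_continuous[OF test_function_smooth[OF assms(3)]])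
  then show m: "\<phi> \<in> borel_measurable (lebesgue_on G)"
    using assms(1)
    by (intro continuous_imp_measurable_on_sets_lebesgue[OF continuous_on_subset]) auto
  have "compact (\<phi> ` closure {x. \<phi> x \<noteq> 0})"
    using assms(3) by (intro compact_continuous_image continuous_on_subset[OF c]) (auto simp: test_function_def)
  then obtain C where C: "\<forall>y\<in>\<phi> ` closure {x. \<phi> x \<noteq> 0}. norm y \<le> C"
    using compact_imp_bounded bounded_iff by metis
  have le: "norm (\<phi> x) \<le> max 0 C" for x
    using C closure_subset[of "{x. \<phi> x \<noteq> 0}"] by (cases "\<phi> x = 0") (auto simp: le_max_iff_disj)
  interpret finite_measure "lebesgue_on G"
    using assms by (intro finite_measure_lebesgue_on lmeasurable_open)
  show "integrable (lebesgue_on G) (\<lambda>x. (norm (\<phi> x))\<^sup>2)"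
  proof (rule integrable_const_bound)
    show "AE x in lebesgue_on G. norm ((norm (\<phi> x))\<^sup>2) \<le> (max 0 C)\<^sup>2"
      using le by (intro AE_I2) (simp add: power_mono del: max_0L)
  qed (rule measurable_norm_sq[OF m])
qed

text \<open>The conjugated components of rot \<phi> are themselves scalar test functions, so the
  weak gradient equation moves the derivatives onto them and leaves h times the conjugate of div rot
  \<phi>, which is 0.\<close>

lemma classical_rot_in_B_space:
  assumes G: "open G" "bounded G" and \<phi>: "test_function G \<phi>"
  shows "classical_rot \<phi> \<in> B_space G"
proof -
  have R: "test_function G (classical_rot \<phi>)"
    by (rule test_function_classical_rot[OF \<phi>])
  have RL: "classical_rot \<phi> \<in> L2 G"
    by (rule test_function_L2[OF G R])
  have "L2_inner G g (classical_rot \<phi>) = 0" if A: "g \<in> A_space G" for g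
  proof -
    obtain h where g: "g \<in> L2 G" and h: "h \<in> L2 G" and w: "has_weak_grad G h g"
      using A by (auto simp: A_space_def)
    \<comment> \<open>The conjugation of the inner product is absorbed into the test function, as
      \<open>has_weak_grad\<close> has none.\<close>
    define \<psi> where "\<psi> i = (\<lambda>x. cnj (classical_rot \<phi> x $ i))" for i
    have bl: "bounded_linear (\<lambda>a :: complex ^ 3. cnj (a $ i))" for i
      by (rule bounded_linear_compose[OF bounded_linear_cnj bounded_linear_vec_nth])
    have \<psi>: "test_function G (\<psi> i)" for i
      unfolding \<psi>_def by (rule test_function_bounded_linear[OF R bl])
    have comp: "(\<lambda>x. g x $ i) \<in> L2 G" for i
    proof (rule L2_I)
      show m: "(\<lambda>x. g x $ i) \<in> borel_measurable (lebesgue_on G)"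
        by (rule borel_measurable_continuous_on[OF bounded_linear.continuous_on[OF bounded_linear_vec_nth
              continuous_on_id] L2_measurable[OF g]])
      show "integrable (lebesgue_on G) (\<lambda>x. (norm (g x $ i))\<^sup>2)"
        by (rule Bochner_Integration.integrable_bound[OF L2_integrable[OF g] measurable_norm_sq[OF m]])
          (auto intro!: AE_I2 power_mono Finite_Cartesian_Product.norm_nth_le)
    qed
    have prod_int: "integrable (lebesgue_on G) (\<lambda>x. a x * b x)"
      if "a \<in> L2 G" "b \<in> L2 G" for a b :: "space3 \<Rightarrow> complex"
      by (rule Bochner_Integration.integrable_bound[OF integrable_norm_mult_L2[OF that]])
        (auto intro!: borel_measurable_times that[THEN L2_measurable] simp: norm_mult)
    have pdL: "(\<lambda>x. pd i (\<psi> i) x) \<in> L2 G" for i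
      unfolding pd_def by (rule test_function_L2[OF G test_function_deriv[OF \<psi>]])
    have "L2_inner G g (classical_rot \<phi>) = (\<Sum>i\<in>UNIV. LINT x|lebesgue_on G. g x $ i * \<psi> i x)"
      unfolding L2_inner_def fun_cong[OF \<psi>_def, symmetric]
      by (rule Bochner_Integration.integral_sum) (rule prod_int[OF comp test_function_L2[OF G \<psi>]])
    also have "\<dots> = (\<Sum>i\<in>UNIV. - (LINT x|lebesgue_on G. h x * pd i (\<psi> i) x))"
      using w \<psi> by (intro sum.cong) (auto simp: has_weak_grad_def)
    also have "\<dots> = - (LINT x|lebesgue_on G. (\<Sum>i\<in>UNIV. h x * pd i (\<psi> i) x))"
      unfolding sum_negf by (subst Bochner_Integration.integral_sum) (auto intro!: prod_int h pdL)
    also have "(\<lambda>x. \<Sum>i\<in>UNIV. h x * pd i (\<psi> i) x) = (\<lambda>x. 0)"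
    proof
      fix x
      have "pd i (\<psi> i) x = cnj (pd i (\<lambda>y. classical_rot \<phi> y $ i) x)" for i
        unfolding \<psi>_def
        by (rule pd_bounded_linear[OF bounded_linear_cnj smooth_component[OF test_function_smooth[OF R]]])
      then have "(\<Sum>i\<in>UNIV. pd i (\<psi> i) x) = cnj (\<Sum>i\<in>UNIV. pd i (\<lambda>y. classical_rot \<phi> y $ i) x)"
        by simp
      also have "\<dots> = 0"
        by (simp only: divergence_classical_rot[OF test_function_smooth[OF \<phi>]] complex_cnj_zero)
      finally show "(\<Sum>i\<in>UNIV. h x * pd i (\<psi> i) x) = 0"
        by (simp only: sum_distrib_left[symmetric] mult_zero_right)
    qed
    finally show ?thesis
      by simp
  qed
  then have "L2_inner G (classical_rot \<phi>) g = 0" if "g \<in> A_space G" for g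
    using that cnj_L2_inner[of G g "classical_rot \<phi>"] by simp
  then show ?thesis
    using RL by (simp add: B_space_def)
qed

text \<open>Orthogonality to \<open>BH_space G\<close> is the equation of vanishing weak rotation,
  tested against \<phi>. This supplies explicit elements of \<open>V0_space G\<close>.\<close>

lemma classical_rot_in_V0_space:
  assumes "open G" "bounded G" "test_function G \<phi>"
  shows "classical_rot \<phi> \<in> V0_space G"
proof -
  have "L2_inner G (classical_rot \<phi>) v = 0" if "v \<in> BH_space G" for v
  proof -
    have "L2_inner G v (classical_rot \<phi>) = 0"
      using that assms(3) by (simp add: BH_space_def has_weak_rot_def)
    then show ?thesis
      using cnj_L2_inner[of G v "classical_rot \<phi>"] by simp
  qed
  then show ?thesis
    using classical_rot_in_B_space[OF assms] by (simp add: V0_space_def)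
qed

text \<open>The linear field (0, x_1, 0) has rotation (0, 0, 1); multiplied by the plateau function
  it becomes a test field whose rotation on the inner ball is that vector times the plateau
  value.\<close>

lemma exists_test_function_locally_constant_rot:
  assumes "open G" "G \<noteq> {}"
  obtains \<phi> p r c where "test_function G \<phi>" "0 < r" "ball p r \<subseteq> G" "c \<noteq> 0"
    "\<forall>x\<in>ball p r. classical_rot \<phi> x = c"
proof -
  obtain p e where e: "0 < e" "cball p e \<subseteq> G"
    using assms open_contains_cball by (metis ex_in_conv)
  \<comment> \<open>The plateau function is supported in the ball of radius 2 r, which has to fit
    into \<open>cball p e\<close>.\<close>
  define r where "r = e / 2"
  have r: "0 < r" "cball p (2 * r) \<subseteq> G"
    using e by (auto simp: r_def)
  define L :: "space3 \<Rightarrow> complex ^ 3" where "L x = axis 2 (complex_of_real (x $ 1))" for x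
  have L: "bounded_linear L"
    unfolding L_def[abs_def]
    by (rule bounded_linear_compose[OF bounded_linear_axis
          bounded_linear_compose[OF bounded_linear_of_real bounded_linear_vec_nth]])
  define \<phi> where "\<phi> x = plateau p r x *\<^sub>R L x" for x
  have sm: "smooth_on UNIV \<phi>"
    unfolding \<phi>_def[abs_def]
    by (rule smooth_bounded_bilinear[OF bounded_bilinear_scaleR smooth_plateau
          smooth_bounded_linear[OF L smooth_ident]])
  have "{x. \<phi> x \<noteq> 0} \<subseteq> cball p (2 * r)"
  proof (rule subsetI, rule ccontr)
    fix x assume "x \<in> {x. \<phi> x \<noteq> 0}" "x \<notin> cball p (2 * r)"
    then show False
      using plateau_outside[OF _ r(1), of x p] by (simp add: \<phi>_def dist_norm norm_minus_commute)
  qed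
  then have sub: "closure {x. \<phi> x \<noteq> 0} \<subseteq> cball p (2 * r)"
    by (rule closure_minimal) simp
  have "compact (closure {x. \<phi> x \<noteq> 0})"
    using compact_Int_closed[OF compact_cball closed_closure, of p "2 * r" "{x. \<phi> x \<noteq> 0}"] sub
    by (simp add: Int_absorb1)
  then have t: "test_function G \<phi>"
    using sm sub r(2) by (auto simp: test_function_def)
  have rot: "classical_rot \<phi> x = axis 3 (complex_of_real (exp (-2)))" if x: "x \<in> ball p r" for x
  proof -
    have bl: "bounded_linear (\<lambda>y. exp (-2) *\<^sub>R L y)"
      by (rule bounded_linear_const_scaleR[OF L])
    have "(\<phi> has_derivative (\<lambda>y. exp (-2) *\<^sub>R L y)) (at x)"
      by (rule has_derivative_transform_within_open[OF bounded_linear_imp_has_derivative[OF bl] open_ball x])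
        (simp add: \<phi>_def plateau_inside dist_norm norm_minus_commute)
    then have "frechet_derivative \<phi> (at x) = (\<lambda>y. exp (-2) *\<^sub>R L y)"
      using frechet_derivative_at by metis
    then have "pd i (\<lambda>y. \<phi> y $ j) x = (exp (-2) *\<^sub>R L (axis i 1)) $ j" for i j
      by (simp only: pd_component[OF sm])
    then show ?thesis
      by (simp add: vec_eq_iff forall_3 classical_rot_nth L_def axis_def complex_eq_iff)
  qed
  have "ball p r \<subseteq> G"
    using r by (auto simp: subset_iff)
  moreover have "axis 3 (complex_of_real (exp (-2))) \<noteq> (0 :: complex ^ 3)"
    by (simp add: axis_eq_0_iff)
  ultimately show thesis
    using that t r(1) rot by blast
qed

section \<open>The eigenbasis\<close>

lemma V0_space_L2: "u \<in> V0_space G \<Longrightarrow> u \<in> L2 G"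
  by (simp add: V0_space_def B_space_def)

text \<open>As the orthogonal complement of a single set, the space is visibly linear and closed
  under limits.\<close>

lemma V0_space_iff:
  "u \<in> V0_space G \<longleftrightarrow> u \<in> L2 G \<and> (\<forall>g \<in> A_space G \<union> BH_space G. L2_inner G u g = 0)"
  by (auto simp: V0_space_def B_space_def)

lemma A_BH_L2: "g \<in> A_space G \<union> BH_space G \<Longrightarrow> g \<in> L2 G"
  by (auto simp: A_space_def BH_space_def B_space_def)

lemma V0_space_zero: "(\<lambda>x. 0) \<in> V0_space G"
  by (simp add: V0_space_iff L2_zero)

lemma V0_space_add: "u \<in> V0_space G \<Longrightarrow> v \<in> V0_space G \<Longrightarrow> (\<lambda>x. u x + v x) \<in> V0_space G"
  using A_BH_L2 by (simp add: V0_space_iff L2_add L2_inner_add_left)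

lemma V0_space_scale: "u \<in> V0_space G \<Longrightarrow> (\<lambda>x. k *s u x) \<in> V0_space G"
  by (simp add: V0_space_iff L2_scale L2_inner_scale_left)

lemma V0_space_diff: "u \<in> V0_space G \<Longrightarrow> v \<in> V0_space G \<Longrightarrow> (\<lambda>x. u x - v x) \<in> V0_space G"
  using A_BH_L2 by (simp add: V0_space_iff L2_diff L2_inner_diff_left)

lemma V0_space_sum:
  assumes "\<And>i. i \<in> F \<Longrightarrow> u i \<in> V0_space G"
  shows "(\<lambda>x. \<Sum>i\<in>F. u i x) \<in> V0_space G"
  using assms
  by (induction F rule: infinite_finite_induct) (auto intro: V0_space_zero V0_space_add)

lemma V0_space_cong: "eq_L2 G u v \<Longrightarrow> u \<in> V0_space G \<Longrightarrow> v \<in> L2 G \<Longrightarrow> v \<in> V0_space G"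
  using A_BH_L2 by (simp add: V0_space_iff L2_inner_cong_left[symmetric, of G u v])

lemma L2_inner_tendsto:
  assumes lim: "((\<lambda>j. L2_norm G (\<lambda>x. s j x - u x)) \<longlongrightarrow> 0) F"
    and "\<And>j. s j \<in> L2 G" "u \<in> L2 G" "w \<in> L2 G"
  shows "((\<lambda>j. L2_inner G (s j) w) \<longlongrightarrow> L2_inner G u w) F"
proof -
  have "((\<lambda>j. L2_inner G (s j) w - L2_inner G u w) \<longlongrightarrow> 0) F"
  proof (rule Lim_null_comparison[OF always_eventually[OF allI]])
    show "norm (L2_inner G (s j) w - L2_inner G u w) \<le> L2_norm G (\<lambda>x. s j x - u x) * L2_norm G w" for j
      using L2_Cauchy_Schwarz[OF L2_diff[OF assms(2,3)] assms(4), of j]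
      by (simp add: L2_inner_diff_left assms)
    show "((\<lambda>j. L2_norm G (\<lambda>x. s j x - u x) * L2_norm G w) \<longlongrightarrow> 0) F"
      by (rule tendsto_mult_left_zero[OF lim])
  qed
  then show ?thesis
    by (simp add: LIM_zero_iff)
qed

lemma V0_space_closed:
  assumes lim: "((\<lambda>j. L2_norm G (\<lambda>x. s j x - u x)) \<longlongrightarrow> 0) F" and F: "F \<noteq> bot"
    and s: "\<And>j. s j \<in> V0_space G" and u: "u \<in> L2 G"
  shows "u \<in> V0_space G"
  unfolding V0_space_iff
proof (intro conjI ballI u)
  fix g assume g: "g \<in> A_space G \<union> BH_space G"
  have "((\<lambda>j. L2_inner G (s j) g) \<longlongrightarrow> L2_inner G u g) F"
    by (rule L2_inner_tendsto[OF lim V0_space_L2[OF s] u A_BH_L2[OF g]])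
  moreover have "L2_inner G (s j) g = 0" for j
    using s[of j] g by (simp add: V0_space_iff)
  ultimately show "L2_inner G u g = 0"
    using F by (simp add: tendsto_const_iff)
qed

text \<open>The rotation required for membership in \<open>W1_space G\<close> is witnessed by w
  itself.\<close>

lemma S_graph_iff: "(u, w) \<in> S_graph G \<longleftrightarrow> u \<in> V0_space G \<and> w \<in> V0_space G \<and> has_weak_rot G u w"
  by (auto simp: S_graph_def W1_space_def)

lemma S_graph_zero: "(\<lambda>x. 0, \<lambda>x. 0) \<in> S_graph G"
  by (simp add: S_graph_iff V0_space_zero has_weak_rot_def)

lemma S_graph_scale: "(u, w) \<in> S_graph G \<Longrightarrow> (\<lambda>x. k *s u x, \<lambda>x. k *s w x) \<in> S_graph G"
  by (simp add: S_graph_iff V0_space_scale has_weak_rot_def L2_inner_scale_left)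

section \<open>Orthonormal series\<close>

lemma L2_has_sum_tendsto:
  "L2_has_sum G f I s \<Longrightarrow> ((\<lambda>F. L2_norm G (\<lambda>x. (\<Sum>i\<in>F. f i x) - s x)) \<longlongrightarrow> 0) (finite_subsets_at_top I)"
  by (simp add: L2_has_sum_def)

lemma vector_scalar_mult_sum: "k *s (\<Sum>i\<in>F. f i :: complex ^ 3) = (\<Sum>i\<in>F. k *s f i)"
  by (simp add: vec_eq_iff sum_distrib_left)

lemma L2_norm_sum_sq:
  assumes "\<And>i. e i \<in> L2 G" "\<And>i j. L2_inner G (e i) (e j) = (if i = j then 1 else 0)" "finite F"
  shows "(L2_norm G (\<lambda>x. \<Sum>i\<in>F. a i *s e i x))\<^sup>2 = (\<Sum>i\<in>F. (cmod (a i))\<^sup>2)"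
proof -
  have "complex_of_real ((L2_norm G (\<lambda>x. \<Sum>i\<in>F. a i *s e i x))\<^sup>2)
      = (\<Sum>i\<in>F. \<Sum>j\<in>F. a i * (cnj (a j) * (if i = j then 1 else 0)))"
    unfolding L2_inner_self[symmetric]
    by (simp add: L2_inner_sum_left L2_inner_sum_right L2_sum L2_scale assms(1,2)
        L2_inner_scale_left L2_inner_scale_right sum_distrib_left)
  also have "\<dots> = (\<Sum>i\<in>F. a i * cnj (a i))"
    using assms(3) by (intro sum.cong refl) (simp add: if_distrib[of "\<lambda>z. _ * z"] cong: if_cong)
  also have "\<dots> = complex_of_real (\<Sum>i\<in>F. (cmod (a i))\<^sup>2)"
    by (simp only: of_real_sum complex_norm_square)
  finally show ?thesis
    by (simp only: of_real_eq_iff)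
qed

text \<open>Convergence is along the net of finite subsets of an arbitrary index type, whereas
  \<open>L2_complete\<close> is about sequences. A sequence of finite sets that nearly exhaust the
  supremum of the square sums links the two: whatever is added beyond the n-th set has norm at most
  2^-n.\<close>

lemma Riesz_Fischer:
  assumes e: "\<And>i. e i \<in> L2 G" and on: "\<And>i j. L2_inner G (e i) (e j) = (if i = j then 1 else 0)"
    and bound: "\<And>F. finite F \<Longrightarrow> (\<Sum>i\<in>F. (cmod (a i))\<^sup>2) \<le> C"
  obtains u where "u \<in> L2 G" "L2_has_sum G (\<lambda>i x. a i *s e i x) UNIV u"
proof -
  define \<sigma> where "\<sigma> F x = (\<Sum>i\<in>F. a i *s e i x)" for F x
  have \<sigma>: "\<sigma> F \<in> L2 G" for F
    unfolding \<sigma>_def[abs_def] by (intro L2_sum L2_scale e)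
  define q where "q F = (\<Sum>i\<in>F. (cmod (a i))\<^sup>2)" for F
  have q: "(L2_norm G (\<sigma> F))\<^sup>2 = q F" if "finite F" for F
    unfolding \<sigma>_def[abs_def] q_def by (rule L2_norm_sum_sq[OF e on that])
  have bdd: "bdd_above (q ` {F. finite F})"
    using bound by (auto simp: bdd_above_def q_def)
  \<comment> \<open>The gap is 4^-n because it bounds a squared norm, whose root must meet the rate
    of \<open>L2_complete\<close>.\<close>
  have "\<exists>H. finite H \<and> Sup (q ` {F. finite F}) - ((1/2) ^ n)\<^sup>2 < q H" for n
    using less_cSup_iff[OF _ bdd, of "Sup (q ` {F. finite F}) - ((1/2) ^ n)\<^sup>2"] by auto
  then obtain H where H: "\<And>n. finite (H n)" "\<And>n. Sup (q ` {F. finite F}) - ((1/2) ^ n)\<^sup>2 < q (H n)"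
    by metis
  \<comment> \<open>Unions make the chain increasing, so that the partial sums over it are
    Cauchy.\<close>
  define K where "K n = (\<Union>k\<le>n. H k)" for n
  have K: "finite (K n)" "H n \<subseteq> K n" for n
    using H by (auto simp: K_def)
  have Kmono: "n \<le> m \<Longrightarrow> K n \<subseteq> K m" for n m
    by (auto simp: K_def intro: order_trans)
  have close: "L2_norm G (\<lambda>x. \<sigma> F x - \<sigma> (K n) x) \<le> (1/2) ^ n" if F: "finite F" "K n \<subseteq> F" for F n
  proof -
    have "\<sigma> F x - \<sigma> (K n) x = \<sigma> (F - K n) x" for x
      unfolding \<sigma>_def by (rule sum_diff[symmetric]) (use F in auto)
    then have "(L2_norm G (\<lambda>x. \<sigma> F x - \<sigma> (K n) x))\<^sup>2 = q (F - K n)"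
      using q[of "F - K n"] F by simp
    also have "\<dots> = q F - q (K n)"
      unfolding q_def by (rule sum_diff) (use F in auto)
    also have "\<dots> \<le> Sup (q ` {F. finite F}) - q (H n)"
    proof (rule diff_mono)
      show "q F \<le> Sup (q ` {F. finite F})"
        using F(1) by (intro cSup_upper bdd) auto
      show "q (H n) \<le> q (K n)"
        unfolding q_def by (rule sum_mono2) (use K in auto)
    qed
    also have "\<dots> \<le> ((1/2) ^ n)\<^sup>2"
      using H(2)[of n] by simp
    finally show ?thesis
      by (rule power2_le_imp_le) simp
  qed
  obtain u where u: "u \<in> L2 G" "\<And>n. L2_norm G (\<lambda>x. u x - \<sigma> (K n) x) \<le> (1/2) ^ n"
    using L2_complete[of "\<lambda>n. \<sigma> (K n)", OF \<sigma> close[OF K(1) Kmono]] by blast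
  have "((\<lambda>F. L2_norm G (\<lambda>x. \<sigma> F x - u x)) \<longlongrightarrow> 0) (finite_subsets_at_top UNIV)"
  proof (rule tendstoI)
    fix \<epsilon> :: real assume "0 < \<epsilon>"
    then obtain n where n: "(1/2) ^ n < \<epsilon> / 2"
      using real_arch_pow_inv[of "\<epsilon> / 2" "1 / 2"] by auto
    show "\<forall>\<^sub>F F in finite_subsets_at_top UNIV. dist (L2_norm G (\<lambda>x. \<sigma> F x - u x)) 0 < \<epsilon>"
      unfolding eventually_finite_subsets_at_top
    proof (intro exI[of _ "K n"] conjI allI impI K(1) subset_UNIV)
      fix F assume F: "finite F \<and> K n \<subseteq> F \<and> F \<subseteq> UNIV"
      have "L2_norm G (\<lambda>x. \<sigma> F x - u x)
          \<le> L2_norm G (\<lambda>x. \<sigma> F x - \<sigma> (K n) x) + L2_norm G (\<lambda>x. \<sigma> (K n) x - u x)"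
        by (rule L2_norm_triangle_diff[OF \<sigma> \<sigma> u(1)])
      also have "L2_norm G (\<lambda>x. \<sigma> (K n) x - u x) = L2_norm G (\<lambda>x. u x - \<sigma> (K n) x)"
        by (rule L2_norm_minus_commute)
      finally show "dist (L2_norm G (\<lambda>x. \<sigma> F x - u x)) 0 < \<epsilon>"
        using close[of F n] F u(2)[of n] n by simp
    qed
  qed
  then show thesis
    using u(1) by (intro that) (simp_all add: L2_has_sum_def \<sigma>_def)
qed

text \<open>The two families are merged into one with signed eigenvalues; the theorem uses the index
  type \<open>nat + nat\<close> and takes \<open>lam 0\<close> for \<delta>.\<close>

locale rot_eigenbasis =
  fixes G :: "space3 set" and e :: "'i \<Rightarrow> field3" and ev :: "'i \<Rightarrow> real" and \<delta> :: real
  assumes open_G: "open G" and bounded_G: "bounded G" and nonempty_G: "G \<noteq> {}"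
    and eig: "(e i, \<lambda>x. complex_of_real (ev i) *s e i x) \<in> S_graph G"
    and onb: "orthonormal_basis G (V0_space G) e"
    and \<delta>_pos: "0 < \<delta>" and \<delta>_le: "\<delta> \<le> \<bar>ev i\<bar>"
begin

section \<open>Linearity and closedness of the graph of S\<close>

lemma e_V0: "e i \<in> V0_space G"
  using onb by (simp add: orthonormal_basis_def)

lemma e_L2: "e i \<in> L2 G"
  by (rule V0_space_L2[OF e_V0])

lemma orthonormal: "L2_inner G (e i) (e j) = (if i = j then 1 else 0)"
  using onb by (simp add: orthonormal_basis_def)

lemma test_L2: "test_function G \<phi> \<Longrightarrow> (\<phi> :: field3) \<in> L2 G"
  by (rule test_function_L2[OF open_G bounded_G])

lemma rot_test_L2: "test_function G \<phi> \<Longrightarrow> classical_rot \<phi> \<in> L2 G"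
  by (rule test_L2[OF test_function_classical_rot])

lemma S_graph_add:
  assumes "(u, w) \<in> S_graph G" "(u', w') \<in> S_graph G"
  shows "(\<lambda>x. u x + u' x, \<lambda>x. w x + w' x) \<in> S_graph G"
  using assms
  by (simp add: S_graph_iff V0_space_add has_weak_rot_def L2_inner_add_left V0_space_L2 test_L2 rot_test_L2)

lemma S_graph_diff:
  assumes "(u, w) \<in> S_graph G" "(u', w') \<in> S_graph G"
  shows "(\<lambda>x. u x - u' x, \<lambda>x. w x - w' x) \<in> S_graph G"
  using assms
  by (simp add: S_graph_iff V0_space_diff has_weak_rot_def L2_inner_diff_left V0_space_L2 test_L2 rot_test_L2)

lemma S_graph_sum:
  assumes "\<And>i. i \<in> F \<Longrightarrow> (u i, w i) \<in> S_graph G"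
  shows "(\<lambda>x. \<Sum>i\<in>F. u i x, \<lambda>x. \<Sum>i\<in>F. w i x) \<in> S_graph G"
  using assms
  by (induction F rule: infinite_finite_induct) (auto intro: S_graph_zero S_graph_add)

lemma S_graph_cong:
  assumes "(u, w) \<in> S_graph G" "eq_L2 G u u'" "eq_L2 G w w'" "u' \<in> L2 G" "w' \<in> L2 G"
  shows "(u', w') \<in> S_graph G"
  using assms V0_space_cong[of G u u'] V0_space_cong[of G w w']
  by (simp add: S_graph_iff has_weak_rot_def V0_space_L2 test_L2 rot_test_L2
      L2_inner_cong_left[symmetric, of G u u'] L2_inner_cong_left[symmetric, of G w w'])

text \<open>For a fixed test field both sides of the weak rotation equation are inner products with
  fixed elements of \<open>L2 G\<close>, hence continuous.\<close>

lemma S_graph_closed: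
  assumes u: "((\<lambda>j. L2_norm G (\<lambda>x. s j x - u x)) \<longlongrightarrow> 0) F" "u \<in> L2 G"
    and w: "((\<lambda>j. L2_norm G (\<lambda>x. t j x - w x)) \<longlongrightarrow> 0) F" "w \<in> L2 G"
    and F: "F \<noteq> bot" and st: "\<And>j. (s j, t j) \<in> S_graph G"
  shows "(u, w) \<in> S_graph G"
  unfolding S_graph_iff
proof (intro conjI)
  have s: "s j \<in> V0_space G" and t: "t j \<in> V0_space G" for j
    using st[of j] by (auto simp: S_graph_iff)
  show "u \<in> V0_space G"
    by (rule V0_space_closed[OF u(1) F s u(2)])
  show "w \<in> V0_space G"
    by (rule V0_space_closed[OF w(1) F t w(2)])
  show "has_weak_rot G u w"
    unfolding has_weak_rot_def
  proof (intro allI impI)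
    fix \<phi> :: field3 assume \<phi>: "test_function G \<phi>"
    have 1: "((\<lambda>j. L2_inner G (s j) (classical_rot \<phi>)) \<longlongrightarrow> L2_inner G u (classical_rot \<phi>)) F"
      by (rule L2_inner_tendsto[OF u(1) V0_space_L2[OF s] u(2) rot_test_L2[OF \<phi>]])
    have 2: "((\<lambda>j. L2_inner G (t j) \<phi>) \<longlongrightarrow> L2_inner G w \<phi>) F"
      by (rule L2_inner_tendsto[OF w(1) V0_space_L2[OF t] w(2) test_L2[OF \<phi>]])
    have "L2_inner G (s j) (classical_rot \<phi>) = L2_inner G (t j) \<phi>" for j
      using st[of j] \<phi> by (simp add: S_graph_iff has_weak_rot_def)
    then show "L2_inner G u (classical_rot \<phi>) = L2_inner G w \<phi>"
      using tendsto_unique[OF F 1] 2 by simp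
  qed
qed

text \<open>\<open>V\<^sup>0\<close> is orthogonal to the fields with vanishing rotation in \<open>\<B>\<close>.\<close>

lemma S_graph_injective:
  assumes "(u, w) \<in> S_graph G" "eq_L2 G w (\<lambda>x. 0)"
  shows "eq_L2 G u (\<lambda>x. 0)"
proof -
  have uV: "u \<in> V0_space G"
    using assms(1) by (simp add: S_graph_iff)
  have "(u, \<lambda>x. 0) \<in> S_graph G"
    using S_graph_cong[OF assms(1) _ assms(2) V0_space_L2[OF uV] L2_zero] by (simp add: eq_L2_def)
  then have "u \<in> BH_space G"
    using uV by (simp add: S_graph_iff BH_space_def V0_space_def)
  then have "L2_inner G u u = 0"
    using uV by (simp add: V0_space_def)
  then have "L2_norm G u = 0"
    unfolding L2_inner_self by simp
  then show ?thesis
    using L2_norm_eq_0_iff[OF V0_space_L2[OF uV]] by simp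
qed

section \<open>Coefficients in the basis and diagonal operators\<close>

lemma Bessel:
  assumes f: "f \<in> L2 G" and F: "finite F"
  shows "(\<Sum>i\<in>F. (cmod (L2_inner G f (e i)))\<^sup>2) \<le> (L2_norm G f)\<^sup>2"
proof -
  define g where "g x = (\<Sum>i\<in>F. L2_inner G f (e i) *s e i x)" for x
  define q where "q = (\<Sum>i\<in>F. (cmod (L2_inner G f (e i)))\<^sup>2)"
  have g: "g \<in> L2 G"
    unfolding g_def[abs_def] by (intro L2_sum L2_scale e_L2)
  have gg: "L2_inner G g g = complex_of_real q"
    unfolding L2_inner_self g_def[abs_def] q_def by (simp only: L2_norm_sum_sq[OF e_L2 orthonormal F])
  have "L2_inner G f g = (\<Sum>i\<in>F. cnj (L2_inner G f (e i)) * L2_inner G f (e i))"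
    unfolding g_def[abs_def] by (simp add: L2_inner_sum_right L2_scale e_L2 f L2_inner_scale_right)
  also have "\<dots> = complex_of_real q"
    unfolding q_def of_real_sum by (intro sum.cong refl) (simp only: complex_norm_square mult.commute)
  finally have fg: "L2_inner G f g = complex_of_real q" .
  then have gf: "L2_inner G g f = complex_of_real q"
    using cnj_L2_inner[of G f g] by simp
  have "complex_of_real ((L2_norm G (\<lambda>x. f x - g x))\<^sup>2) = complex_of_real ((L2_norm G f)\<^sup>2 - q)"
    using L2_diff[OF f g] unfolding L2_inner_self[symmetric] of_real_diff
    by (simp add: L2_inner_diff_left L2_inner_diff_right f g fg gf gg)
  then have "(L2_norm G (\<lambda>x. f x - g x))\<^sup>2 = (L2_norm G f)\<^sup>2 - q"
    by (simp only: of_real_eq_iff)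
  then show ?thesis
    unfolding q_def[symmetric] by (metis diff_ge_0_iff_ge zero_le_power2)
qed

lemma L2_has_sum_coeff:
  assumes s: "L2_has_sum G (\<lambda>i x. a i *s e i x) UNIV u" and u: "u \<in> L2 G"
  shows "L2_inner G u (e j) = a j"
proof -
  have "((\<lambda>F. L2_inner G (\<lambda>x. \<Sum>i\<in>F. a i *s e i x) (e j)) \<longlongrightarrow> L2_inner G u (e j)) (finite_subsets_at_top UNIV)"
    by (rule L2_inner_tendsto[OF L2_has_sum_tendsto[OF s] _ u e_L2]) (intro L2_sum L2_scale e_L2)
  moreover have "((\<lambda>F. L2_inner G (\<lambda>x. \<Sum>i\<in>F. a i *s e i x) (e j)) \<longlongrightarrow> a j) (finite_subsets_at_top UNIV)"
  proof (rule tendsto_eventually)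
    show "\<forall>\<^sub>F F in finite_subsets_at_top UNIV. L2_inner G (\<lambda>x. \<Sum>i\<in>F. a i *s e i x) (e j) = a j"
      unfolding eventually_finite_subsets_at_top
    proof (intro exI[of _ "{j}"] conjI allI impI)
      fix F assume "finite F \<and> {j} \<subseteq> F \<and> F \<subseteq> UNIV"
      then show "L2_inner G (\<lambda>x. \<Sum>i\<in>F. a i *s e i x) (e j) = a j"
        by (simp add: L2_inner_sum_left L2_scale e_L2 L2_inner_scale_left orthonormal
            if_distrib[of "\<lambda>z. _ * z"] cong: if_cong)
    qed auto
  qed
  ultimately show ?thesis
    by (rule tendsto_unique[OF finite_subsets_at_top_neq_bot])
qed

text \<open>Totality of the basis is given as approximability: if g is a combination within
  \<epsilon> of h, then |h|^2 = (h, h - g) \<le> |h| \<epsilon>.\<close>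

lemma V0_eq_zero:
  assumes h: "h \<in> V0_space G" and orth: "\<And>i. L2_inner G h (e i) = 0"
  shows "eq_L2 G h (\<lambda>x. 0)"
proof -
  have hL: "h \<in> L2 G"
    by (rule V0_space_L2[OF h])
  have "L2_norm G h \<le> 0 + \<epsilon>" if \<epsilon>: "0 < \<epsilon>" for \<epsilon>
  proof -
    obtain F c where F: "finite F" "L2_norm G (\<lambda>x. h x - (\<Sum>i\<in>F. c i *s e i x)) < \<epsilon>"
      using onb h \<epsilon> unfolding orthonormal_basis_def by blast
    define g where "g x = (\<Sum>i\<in>F. c i *s e i x)" for x
    have g: "g \<in> L2 G"
      unfolding g_def[abs_def] by (intro L2_sum L2_scale e_L2)
    have "L2_inner G h g = 0"
      unfolding g_def[abs_def]
      by (simp add: L2_inner_sum_right L2_scale e_L2 hL L2_inner_scale_right orth)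
    then have "L2_inner G h h = L2_inner G h (\<lambda>x. h x - g x)"
      by (simp add: L2_inner_diff_right hL g)
    moreover have "cmod (L2_inner G h h) = (L2_norm G h)\<^sup>2"
      unfolding L2_inner_self norm_of_real by simp
    ultimately have "(L2_norm G h)\<^sup>2 \<le> L2_norm G h * L2_norm G (\<lambda>x. h x - g x)"
      using L2_Cauchy_Schwarz[OF hL L2_diff[OF hL g]] by simp
    also have "\<dots> \<le> L2_norm G h * \<epsilon>"
      using F(2) by (intro mult_left_mono) (auto simp: g_def)
    finally have "L2_norm G h * L2_norm G h \<le> L2_norm G h * \<epsilon>"
      by (simp add: power2_eq_square)
    then show ?thesis
      using \<epsilon> by (cases "L2_norm G h = 0") (auto simp: mult_le_cancel_left order.strict_iff_order)
  qed
  then have "L2_norm G h \<le> 0"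
    by (rule field_le_epsilon)
  then show ?thesis
    using L2_norm_eq_0_iff[OF hL] L2_norm_nonneg[of G h] by linarith
qed

lemma V0_eqI:
  assumes f: "f \<in> V0_space G" and g: "g \<in> V0_space G" and eq: "\<And>i. L2_inner G f (e i) = L2_inner G g (e i)"
  shows "eq_L2 G f g"
proof -
  have "eq_L2 G (\<lambda>x. f x - g x) (\<lambda>x. 0)"
    by (rule V0_eq_zero[OF V0_space_diff[OF f g]])
      (simp add: L2_inner_diff_left V0_space_L2 f g e_L2 eq)
  then show ?thesis
    by (simp add: eq_L2_def)
qed

text \<open>Bounded diagonal operators act on \<open>V0_space G\<close>: Bessel's inequality bounds
  the square sums, Riesz-Fischer sums the series, and closedness keeps the sum in the space.\<close>

lemma multiplier_sum:
  assumes f: "f \<in> V0_space G" and m: "\<And>i. cmod (m i) \<le> C"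
  obtains u where "u \<in> V0_space G" "L2_has_sum G (\<lambda>i x. (m i * L2_inner G f (e i)) *s e i x) UNIV u"
proof -
  have "(\<Sum>i\<in>F. (cmod (m i * L2_inner G f (e i)))\<^sup>2) \<le> C\<^sup>2 * (L2_norm G f)\<^sup>2" if F: "finite F" for F
  proof -
    have "(\<Sum>i\<in>F. (cmod (m i * L2_inner G f (e i)))\<^sup>2) \<le> (\<Sum>i\<in>F. C\<^sup>2 * (cmod (L2_inner G f (e i)))\<^sup>2)"
      unfolding norm_mult power_mult_distrib
      by (intro sum_mono mult_right_mono power_mono m) auto
    also have "\<dots> \<le> C\<^sup>2 * (L2_norm G f)\<^sup>2"
      unfolding sum_distrib_left[symmetric]
      by (intro mult_left_mono Bessel V0_space_L2 f F) auto
    finally show ?thesis .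
  qed
  from Riesz_Fischer[OF e_L2 orthonormal this]
  obtain u where u: "u \<in> L2 G" "L2_has_sum G (\<lambda>i x. (m i * L2_inner G f (e i)) *s e i x) UNIV u"
    by blast
  have sV: "(\<lambda>x. \<Sum>i\<in>F. (m i * L2_inner G f (e i)) *s e i x) \<in> V0_space G" for F
    by (intro V0_space_sum V0_space_scale e_V0)
  have "u \<in> V0_space G"
    by (rule V0_space_closed[OF L2_has_sum_tendsto[OF u(2)] finite_subsets_at_top_neq_bot sV u(1)])
  then show thesis
    using u(2) that by blast
qed

text \<open>Takes the place of Parseval's identity: the partial sums for g are bounded by Bessel's
  inequality for f, and the bound survives the limit.\<close>

lemma V0_norm_mono:
  assumes f: "f \<in> V0_space G" and g: "g \<in> V0_space G" and "0 \<le> \<rho>"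
    and le: "\<And>i. cmod (L2_inner G g (e i)) \<le> \<rho> * cmod (L2_inner G f (e i))"
  shows "L2_norm G g \<le> \<rho> * L2_norm G f"
proof -
  \<comment> \<open>The multiplier 1 yields the Fourier series of g; its sum h agrees with g almost
    everywhere, the coefficients being equal.\<close>
  obtain h where h: "h \<in> V0_space G" "L2_has_sum G (\<lambda>i x. (1 * L2_inner G g (e i)) *s e i x) UNIV h"
    using multiplier_sum[OF g, of "\<lambda>_. 1" 1] by auto
  define s where "s F = (\<lambda>x. \<Sum>i\<in>F. (1 * L2_inner G g (e i)) *s e i x)" for F
  have s: "s F \<in> L2 G" for F
    unfolding s_def by (intro L2_sum L2_scale e_L2)
  have hg: "eq_L2 G h g"
    by (rule V0_eqI[OF h(1) g]) (simp add: L2_has_sum_coeff[OF h(2) V0_space_L2[OF h(1)]])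
  have "L2_norm G h = L2_norm G g"
    unfolding L2_norm_def using hg by (intro arg_cong[where f=sqrt] Bochner_Integration.integral_cong_AE)
      (auto simp: eq_L2_def intro!: measurable_norm_sq L2_measurable[OF V0_space_L2] h(1) g)
  have sF: "L2_norm G (s F) \<le> \<rho> * L2_norm G f" if F: "finite F" for F
  proof (rule power2_le_imp_le)
    have "(L2_norm G (s F))\<^sup>2 = (\<Sum>i\<in>F. (cmod (L2_inner G g (e i)))\<^sup>2)"
      unfolding s_def by (subst L2_norm_sum_sq[OF e_L2 orthonormal F]) simp
    also have "\<dots> \<le> (\<Sum>i\<in>F. \<rho>\<^sup>2 * (cmod (L2_inner G f (e i)))\<^sup>2)"
      unfolding power_mult_distrib[symmetric] by (intro sum_mono power_mono le) auto
    also have "\<dots> \<le> \<rho>\<^sup>2 * (L2_norm G f)\<^sup>2"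
      unfolding sum_distrib_left[symmetric]
      by (intro mult_left_mono Bessel V0_space_L2 f F) auto
    finally show "(L2_norm G (s F))\<^sup>2 \<le> (\<rho> * L2_norm G f)\<^sup>2"
      by (simp only: power_mult_distrib)
  qed (use assms in auto)
  have "((\<lambda>F. L2_norm G (\<lambda>x. s F x - h x) + \<rho> * L2_norm G f) \<longlongrightarrow> 0 + \<rho> * L2_norm G f)
      (finite_subsets_at_top UNIV)"
    using L2_has_sum_tendsto[OF h(2)] by (intro tendsto_add tendsto_const) (simp add: s_def)
  moreover have "\<forall>\<^sub>F F in finite_subsets_at_top UNIV. L2_norm G h \<le> L2_norm G (\<lambda>x. s F x - h x) + \<rho> * L2_norm G f"
  proof (rule eventually_finite_subsets_at_top_weakI)
    fix F :: "'i set" assume F: "finite F"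
    have "L2_norm G h \<le> L2_norm G (\<lambda>x. h x - s F x) + L2_norm G (s F)"
      using L2_norm_triangle[OF L2_diff[OF V0_space_L2[OF h(1)] s[of F]] s[of F]] by simp
    then show "L2_norm G h \<le> L2_norm G (\<lambda>x. s F x - h x) + \<rho> * L2_norm G f"
      using sF[OF F] L2_norm_minus_commute[of G h "s F"] by simp
  qed
  ultimately have "L2_norm G h \<le> 0 + \<rho> * L2_norm G f"
    by (rule tendsto_lowerbound) simp
  then show ?thesis
    using \<open>L2_norm G h = L2_norm G g\<close> by simp
qed

text \<open>Boundedness of m and of ev m makes the series of u and that of the rotations both
  converge; since S is closed, the limits form a pair of its graph.\<close>

lemma multiplier_sum_S_graph:
  assumes f: "f \<in> V0_space G" and m: "\<And>i. cmod (m i) \<le> C" "\<And>i. cmod (complex_of_real (ev i) * m i) \<le> C"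
  obtains u w where "(u, w) \<in> S_graph G" "L2_has_sum G (\<lambda>i x. (m i * L2_inner G f (e i)) *s e i x) UNIV u"
    "\<forall>i. L2_inner G u (e i) = m i * L2_inner G f (e i)"
    "\<forall>i. L2_inner G w (e i) = complex_of_real (ev i) * m i * L2_inner G f (e i)"
proof -
  obtain u where u: "u \<in> V0_space G" "L2_has_sum G (\<lambda>i x. (m i * L2_inner G f (e i)) *s e i x) UNIV u"
    using multiplier_sum[OF f m(1)] .
  obtain w where w: "w \<in> V0_space G"
    "L2_has_sum G (\<lambda>i x. (complex_of_real (ev i) * m i * L2_inner G f (e i)) *s e i x) UNIV w"
    using multiplier_sum[OF f m(2)] .
  have "(\<lambda>x. (m i * L2_inner G f (e i)) *s e i x,
      \<lambda>x. (complex_of_real (ev i) * m i * L2_inner G f (e i)) *s e i x) \<in> S_graph G" for i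
    using S_graph_scale[OF eig[of i], of "m i * L2_inner G f (e i)"]
    by (simp add: vector_smult_assoc mult_ac)
  then have "(u, w) \<in> S_graph G"
    by (intro S_graph_closed[OF L2_has_sum_tendsto[OF u(2)] V0_space_L2[OF u(1)]
          L2_has_sum_tendsto[OF w(2)] V0_space_L2[OF w(1)] finite_subsets_at_top_neq_bot] S_graph_sum)
  then show thesis
    using that u(2) L2_has_sum_coeff[OF u(2) V0_space_L2[OF u(1)]]
      L2_has_sum_coeff[OF w(2) V0_space_L2[OF w(1)]] by blast
qed

text \<open>Since \<open>\<bar>ev i\<bar>\<close> is bounded below, the inverse
  of its restriction to the span of the basis extends to all of \<open>V\<^sup>0\<close>; injectivity then leaves no
  room for a proper extension.\<close>

lemma S_graph_coeff:
  assumes uw: "(u, w) \<in> S_graph G"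
  shows "L2_inner G w (e i) = complex_of_real (ev i) * L2_inner G u (e i)"
proof -
  have u: "u \<in> V0_space G" and w: "w \<in> V0_space G"
    using uw by (auto simp: S_graph_iff)
  have ev0: "ev i \<noteq> 0" for i
    using \<delta>_pos \<delta>_le[of i] by auto
  \<comment> \<open>One constant has to serve both multipliers, 1/ev and ev/ev = 1.\<close>
  have b1: "cmod (inverse (complex_of_real (ev i))) \<le> max 1 (inverse \<delta>)" for i
    using \<delta>_pos \<delta>_le[of i] by (simp add: norm_inverse le_max_iff_disj le_imp_inverse_le)
  have b2: "cmod (complex_of_real (ev i) * inverse (complex_of_real (ev i))) \<le> max 1 (inverse \<delta>)" for i
    using ev0[of i] by simp
  \<comment> \<open>The diagonal preimage of w: w0 agrees with w almost everywhere, so u - u0 is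
    sent to 0 by S.\<close>
  obtain u0 w0 where 0: "(u0, w0) \<in> S_graph G"
    "L2_has_sum G (\<lambda>i x. (inverse (complex_of_real (ev i)) * L2_inner G w (e i)) *s e i x) UNIV u0"
    "\<forall>i. L2_inner G u0 (e i) = inverse (complex_of_real (ev i)) * L2_inner G w (e i)"
    "\<forall>i. L2_inner G w0 (e i) = complex_of_real (ev i) * inverse (complex_of_real (ev i)) * L2_inner G w (e i)"
    using multiplier_sum_S_graph[OF w b1 b2] .
  have V: "u0 \<in> V0_space G" "w0 \<in> V0_space G"
    using 0(1) by (auto simp: S_graph_iff)
  have "eq_L2 G w w0"
    by (rule V0_eqI[OF w V(2)]) (simp add: 0(4) ev0)
  then have "eq_L2 G (\<lambda>x. w x - w0 x) (\<lambda>x. 0)"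
    by (simp add: eq_L2_def)
  then have "eq_L2 G (\<lambda>x. u x - u0 x) (\<lambda>x. 0)"
    by (rule S_graph_injective[OF S_graph_diff[OF uw 0(1)]])
  then have "eq_L2 G u u0"
    by (simp add: eq_L2_def)
  then have "L2_inner G u (e i) = inverse (complex_of_real (ev i)) * L2_inner G w (e i)"
    using L2_inner_cong_left[OF _ V0_space_L2[OF u] V0_space_L2[OF V(1)] e_L2] 0(3) by simp
  then show ?thesis
    using ev0[of i] by simp
qed

text \<open>Source of uniqueness off the spectrum, of the necessity of the solvability condition,
  and of the shape of the kernel.\<close>

lemma S_shift_graph_coeff:
  assumes "(u, f) \<in> S_shift_graph G \<mu>" "f \<in> L2 G"
  shows "L2_inner G f (e i) = (\<mu> + complex_of_real (ev i)) * L2_inner G u (e i)" "u \<in> V0_space G"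
proof -
  obtain w where w: "(u, w) \<in> S_graph G" "eq_L2 G (\<lambda>x. w x + \<mu> *s u x) f"
    using assms(1) by (auto simp: S_shift_graph_def)
  then have L: "u \<in> L2 G" "w \<in> L2 G"
    by (auto simp: S_graph_iff V0_space_L2)
  show "u \<in> V0_space G"
    using w by (simp add: S_graph_iff)
  have "L2_inner G f (e i) = L2_inner G (\<lambda>x. w x + \<mu> *s u x) (e i)"
    by (rule L2_inner_cong_left[OF w(2) L2_add[OF L(2) L2_scale[OF L(1)]] assms(2) e_L2, symmetric])
  also have "\<dots> = (\<mu> + complex_of_real (ev i)) * L2_inner G u (e i)"
    by (simp add: L2_inner_add_left L L2_scale e_L2 L2_inner_scale_left S_graph_coeff[OF w(1)] algebra_simps)
  finally show "L2_inner G f (e i) = (\<mu> + complex_of_real (ev i)) * L2_inner G u (e i)" .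
qed

text \<open>Serves the regular and the resonant case together: \<open>inverse 0 = 0\<close> drops
  the resonant indices, at which f has no component.\<close>

lemma S_shift_graph_solution:
  assumes f: "f \<in> V0_space G" and orth: "\<And>i. \<mu> + complex_of_real (ev i) = 0 \<Longrightarrow> L2_inner G f (e i) = 0"
    and c: "0 < c" "\<And>i. \<mu> + complex_of_real (ev i) \<noteq> 0 \<Longrightarrow> c \<le> cmod (\<mu> + complex_of_real (ev i))"
  obtains u where "(u, f) \<in> S_shift_graph G \<mu>"
    "L2_has_sum G (\<lambda>i x. (inverse (\<mu> + complex_of_real (ev i)) * L2_inner G f (e i)) *s e i x) UNIV u"
proof -
  define m where "m i = inverse (\<mu> + complex_of_real (ev i))" for i
  have m: "cmod (m i) \<le> inverse c" for i
    using c(1) c(2)[of i]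
    by (cases "\<mu> + complex_of_real (ev i) = 0") (auto simp: m_def norm_inverse le_imp_inverse_le)
  \<comment> \<open>Bounded although ev is not: off resonance ev/(\<mu> + ev) = 1 - \<mu>/(\<mu> +
    ev).\<close>
  have evm: "complex_of_real (ev i) * m i = (if \<mu> + complex_of_real (ev i) = 0 then 0 else 1 - \<mu> * m i)" for i
    by (auto simp: m_def field_simps)
  \<comment> \<open>The constant on the right also dominates the bound on m itself, so it serves
    both multipliers.\<close>
  have le: "1 + cmod \<mu> * inverse c \<le> 1 + (1 + cmod \<mu>) * inverse c"
    using c(1) by (simp add: distrib_right)
  have "cmod (1 - \<mu> * m i) \<le> 1 + cmod \<mu> * inverse c" for i
    by (rule order_trans[OF norm_triangle_ineq4]) (auto simp: norm_mult intro: mult_left_mono m)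
  then have b2: "cmod (complex_of_real (ev i) * m i) \<le> 1 + (1 + cmod \<mu>) * inverse c" for i
    unfolding evm using c(1) order_trans[OF _ le] by auto
  have b1: "cmod (m i) \<le> 1 + (1 + cmod \<mu>) * inverse c" for i
    using c(1) by (intro order_trans[OF m[of i]]) (simp add: algebra_simps)
  obtain u w where u: "(u, w) \<in> S_graph G" "L2_has_sum G (\<lambda>i x. (m i * L2_inner G f (e i)) *s e i x) UNIV u"
    "\<forall>i. L2_inner G u (e i) = m i * L2_inner G f (e i)"
    "\<forall>i. L2_inner G w (e i) = complex_of_real (ev i) * m i * L2_inner G f (e i)"
    using multiplier_sum_S_graph[OF f b1 b2] .
  have V: "u \<in> V0_space G" "w \<in> V0_space G"
    using u(1) by (auto simp: S_graph_iff)
  have "eq_L2 G (\<lambda>x. w x + \<mu> *s u x) f"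
  proof (rule V0_eqI[OF V0_space_add[OF V(2) V0_space_scale[OF V(1)]] f])
    fix i
    have "L2_inner G (\<lambda>x. w x + \<mu> *s u x) (e i) = (complex_of_real (ev i) * m i + \<mu> * m i) * L2_inner G f (e i)"
      by (simp add: L2_inner_add_left V V0_space_L2 L2_scale e_L2 L2_inner_scale_left u(3,4) algebra_simps)
    also have "\<dots> = L2_inner G f (e i)"
      using orth[of i] by (simp add: evm)
    finally show "L2_inner G (\<lambda>x. w x + \<mu> *s u x) (e i) = L2_inner G f (e i)" .
  qed
  then have "(u, f) \<in> S_shift_graph G \<mu>"
    using u(1) by (auto simp: S_shift_graph_def)
  then show thesis
    using that u(2) by (simp add: m_def)
qed

text \<open>The symmetry of S against a test field, which is the conjugate of the weak rotation
  equation of \<open>e i\<close>.\<close>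

lemma test_rot_coeff:
  assumes "test_function G \<psi>"
  shows "L2_inner G (classical_rot \<psi>) (e i) = complex_of_real (ev i) * L2_inner G \<psi> (e i)"
proof -
  have "L2_inner G (e i) (classical_rot \<psi>) = complex_of_real (ev i) * L2_inner G (e i) \<psi>"
    using eig[of i] assms by (simp add: S_graph_iff has_weak_rot_def L2_inner_scale_left)
  from arg_cong[OF this, of cnj] show ?thesis
    by (simp add: cnj_L2_inner)
qed

lemma L2_norm_ge_locally_const:
  assumes u: "u \<in> L2 G" and B: "ball p r \<subseteq> G" and c: "\<And>x. x \<in> ball p r \<Longrightarrow> u x = c"
  shows "(norm c)\<^sup>2 * measure lebesgue (ball p r) \<le> (L2_norm G u)\<^sup>2"
proof -
  have sets: "ball p r \<in> sets (lebesgue_on G)" and G: "G \<in> sets lebesgue"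
    using B open_G by (auto simp: sets_restrict_space_iff)
  interpret finite_measure "lebesgue_on G"
    using open_G bounded_G by (intro finite_measure_lebesgue_on lmeasurable_open)
  have "(norm c)\<^sup>2 * measure lebesgue (ball p r) = (LINT x|lebesgue_on G. (norm c)\<^sup>2 * indicator (ball p r) x)"
    using sets B G by (simp add: measure_restrict_space Int_absorb2)
  also have "\<dots> \<le> (LINT x|lebesgue_on G. (norm (u x))\<^sup>2)"
    using sets c
    by (intro integral_mono integrable_mult_right L2_integrable u integrable_real_indicator)
      (auto simp: indicator_def less_top[symmetric])
  finally show ?thesis
    by (simp only: L2_norm_sq)
qed

text \<open>If the eigenvalues were bounded by \<open>\<Lambda>\<close>, then \<open>1 - \<Lambda>\<^sup>-\<^sup>2 rot\<^sup>2\<close> would be a strict contraction of \<open>V\<^sup>0\<close>.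
  It cannot be one, since it maps \<open>rot \<phi>\<close> for a test field \<open>\<phi>\<close> to a field of the same kind and
  preserves the values of \<open>rot \<phi>\<close> on any ball where \<open>rot \<phi>\<close> is constant.\<close>

lemma eigenvalues_unbounded: "\<exists>i. \<Lambda> < \<bar>ev i\<bar>"
proof (rule ccontr)
  assume "\<not> (\<exists>i. \<Lambda> < \<bar>ev i\<bar>)"
  then have \<Lambda>: "\<bar>ev i\<bar> \<le> \<Lambda>" for i
    by (simp add: not_less)
  have \<delta>\<Lambda>: "\<delta> \<le> \<Lambda>"
    using order_trans[OF \<delta>_le \<Lambda>] .
  then have \<Lambda>_pos: "0 < \<Lambda>"
    using \<delta>_pos by linarith
  \<comment> \<open>The largest value of 1 - ev^2/\<Lambda>^2 under \<delta> \<le> |ev| \<le>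
    \<Lambda>.\<close>
  define \<rho> where "\<rho> = 1 - \<delta>\<^sup>2 / \<Lambda>\<^sup>2"
  have \<rho>: "0 \<le> \<rho>" "\<rho> < 1"
    using \<delta>\<Lambda> \<delta>_pos \<Lambda>_pos by (auto simp: \<rho>_def power_mono)
  have factor: "\<bar>1 - (ev i)\<^sup>2 / \<Lambda>\<^sup>2\<bar> \<le> \<rho>" for i
  proof -
    have "\<delta>\<^sup>2 \<le> (ev i)\<^sup>2"
      using \<delta>_le[of i] \<delta>_pos by (simp add: abs_le_square_iff[symmetric])
    moreover have "(ev i)\<^sup>2 \<le> \<Lambda>\<^sup>2"
      using \<Lambda>[of i] \<Lambda>_pos by (simp add: abs_le_square_iff[symmetric])
    ultimately show ?thesis
      using \<Lambda>_pos by (auto simp: \<rho>_def abs_le_iff field_simps)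
  qed
  obtain \<phi>0 p r c where \<phi>0: "test_function G \<phi>0" "0 < r" "ball p r \<subseteq> G" "c \<noteq> 0"
    "\<forall>x\<in>ball p r. classical_rot \<phi>0 x = c"
    using exists_test_function_locally_constant_rot[OF open_G nonempty_G] .
  define k where "k = complex_of_real (1 / \<Lambda>\<^sup>2)"
  \<comment> \<open>The iteration is run on the potentials, so that each \<open>R n\<close> is the
    rotation of a test field and thus in \<open>V0_space G\<close>; \<open>R n\<close> then follows
    the same recursion.\<close>
  define \<phi> where "\<phi> n = ((\<lambda>\<psi> x. \<psi> x - k *s classical_rot (classical_rot \<psi>) x) ^^ n) \<phi>0" for n
  have \<phi>_Suc: "\<phi> (Suc n) = (\<lambda>x. \<phi> n x - k *s classical_rot (classical_rot (\<phi> n)) x)" for n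
    by (simp add: \<phi>_def)
  have T: "test_function G (\<phi> n)" for n
  proof (induction n)
    case (Suc n)
    then show ?case
      unfolding \<phi>_Suc
      by (intro test_function_diff test_function_bounded_linear[OF _ bounded_linear_vector_scalar_mult]
          test_function_classical_rot)
  qed (simp add: \<phi>_def \<phi>0)
  define R where "R n = classical_rot (\<phi> n)" for n
  have RT: "test_function G (R n)" for n
    unfolding R_def by (rule test_function_classical_rot[OF T])
  have R_Suc: "R (Suc n) x = R n x - k *s classical_rot (classical_rot (R n)) x" for n x
    unfolding R_def \<phi>_Suc
    by (intro classical_rot_diff_scale smooth_classical_rot test_function_smooth[OF T])
  have RV: "R n \<in> V0_space G" for n
    unfolding R_def by (rule classical_rot_in_V0_space[OF open_G bounded_G T])
  have const: "R n x = c" if "x \<in> ball p r" for n x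
    using that
  proof (induction n arbitrary: x)
    case 0
    then show ?case
      by (simp add: R_def \<phi>_def \<phi>0)
  next
    case (Suc n)
    \<comment> \<open>\<open>R n\<close> equals c on an open ball, so its first and second rotations
      vanish there and the correction term is 0.\<close>
    have "classical_rot (R n) y = 0" if "y \<in> ball p r" for y
      by (rule classical_rot_locally_const[OF open_ball that Suc.IH])
    then have "classical_rot (classical_rot (R n)) x = 0"
      by (rule classical_rot_locally_const[OF open_ball Suc.prems])
    then show ?case
      by (simp add: R_Suc Suc.IH[OF Suc.prems])
  qed
  have step: "L2_norm G (R (Suc n)) \<le> \<rho> * L2_norm G (R n)" for n
  proof (rule V0_norm_mono[OF RV RV \<rho>(1)])
    fix i
    have T1: "test_function G (classical_rot (R n))"
      by (rule test_function_classical_rot[OF RT])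
    have "L2_inner G (R (Suc n)) (e i)
        = L2_inner G (R n) (e i) - k * L2_inner G (classical_rot (classical_rot (R n))) (e i)"
      unfolding R_Suc[abs_def]
      by (simp add: L2_inner_diff_left test_L2[OF RT] e_L2 L2_scale rot_test_L2[OF T1] L2_inner_scale_left)
    also have "\<dots> = complex_of_real (1 - (ev i)\<^sup>2 / \<Lambda>\<^sup>2) * L2_inner G (R n) (e i)"
      unfolding test_rot_coeff[OF T1] test_rot_coeff[OF RT]
      by (simp add: k_def power2_eq_square algebra_simps)
    finally show "cmod (L2_inner G (R (Suc n)) (e i)) \<le> \<rho> * cmod (L2_inner G (R n) (e i))"
      using factor[of i] by (simp only: norm_mult norm_of_real) (intro mult_right_mono norm_ge_zero)
  qed
  have bound: "L2_norm G (R n) \<le> \<rho> ^ n * L2_norm G (R 0)" for n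
  proof (induction n)
    case (Suc n)
    show ?case
      using order_trans[OF step[of n] mult_left_mono[OF Suc \<rho>(1)]] by (simp add: mult.assoc)
  qed simp
  \<comment> \<open>The norm contributed by the ball alone, the same for all n.\<close>
  define b where "b = norm c * sqrt (measure lebesgue (ball p r))"
  have "0 < measure lebesgue (ball p r)"
    using content_ball_pos[OF \<phi>0(2), of p] by simp
  then have b: "0 < b"
    using \<phi>0(4) by (simp add: b_def)
  have "b\<^sup>2 \<le> (L2_norm G (R n))\<^sup>2" for n
    using L2_norm_ge_locally_const[OF test_L2[OF RT] \<phi>0(3) const, of n]
    by (simp add: b_def power_mult_distrib)
  then have "b \<le> L2_norm G (R n)" for n
    by (rule power2_le_imp_le) simp
  then have "b \<le> \<rho> ^ n * L2_norm G (R 0)" for n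
    using bound order_trans by blast
  moreover have "(\<lambda>n. \<rho> ^ n * L2_norm G (R 0)) \<longlonglongrightarrow> 0"
    using \<rho> by (intro tendsto_mult_left_zero LIMSEQ_realpow_zero)
  ultimately have "b \<le> 0"
    by (intro LIMSEQ_le_const) auto
  then show False
    using b by simp
qed

section \<open>Spectral gap and kernel of the shifted operator\<close>

lemma basis_nonzero: "\<not> eq_L2 G (e i) (\<lambda>x. 0)"
proof -
  have "complex_of_real ((L2_norm G (e i))\<^sup>2) = 1"
    using orthonormal[of i i] unfolding L2_inner_self by simp
  then show ?thesis
    using L2_norm_eq_0_iff[OF e_L2, of i] by auto
qed

text \<open>Eigenvalues of modulus above |\<mu>| + 1 are at distance at least 1 from -\<mu>, and
  only finitely many others remain.\<close>

lemma spectral_gap: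
  assumes fin: "\<And>M. finite {i. \<bar>ev i\<bar> \<le> M}"
  obtains c where "0 < c" "\<forall>i. \<mu> + complex_of_real (ev i) \<noteq> 0 \<longrightarrow> c \<le> cmod (\<mu> + complex_of_real (ev i))"
proof -
  define A where "A = {i. \<bar>ev i\<bar> \<le> cmod \<mu> + 1} \<inter> {i. \<mu> + complex_of_real (ev i) \<noteq> 0}"
  \<comment> \<open>The inserted 1 covers the indices outside \<open>A\<close> and keeps the minimum
    defined when \<open>A\<close> is empty.\<close>
  define c where "c = Min (insert 1 ((\<lambda>i. cmod (\<mu> + complex_of_real (ev i))) ` A))"
  have A: "finite A"
    unfolding A_def using fin by blast
  show thesis
  proof (rule that)
    show "0 < c"
      unfolding c_def using A by (subst Min_gr_iff) (auto simp: A_def)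
    show "\<forall>i. \<mu> + complex_of_real (ev i) \<noteq> 0 \<longrightarrow> c \<le> cmod (\<mu> + complex_of_real (ev i))"
    proof (intro allI impI)
      fix i assume nz: "\<mu> + complex_of_real (ev i) \<noteq> 0"
      show "c \<le> cmod (\<mu> + complex_of_real (ev i))"
      proof (cases "i \<in> A")
        case True
        then show ?thesis
          unfolding c_def using A by (intro Min_le) auto
      next
        case False
        have "c \<le> 1"
          unfolding c_def using A by (intro Min_le) auto
        also have "1 \<le> \<bar>ev i\<bar> - cmod \<mu>"
          using False nz by (simp add: A_def)
        also have "\<dots> \<le> cmod (\<mu> + complex_of_real (ev i))"
          using norm_diff_ineq[of "complex_of_real (ev i)" \<mu>] by (simp add: add.commute)
        finally show ?thesis .
      qed
    qed
  qed
qed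

text \<open>The coefficient equation annihilates every nonresonant coefficient of u, and a field of
  \<open>V0_space G\<close> is determined by its coefficients; the converse is linearity.\<close>

lemma S_shift_kernel:
  assumes fin: "finite {i. \<mu> + complex_of_real (ev i) = 0}"
  shows "(u, \<lambda>x. 0) \<in> S_shift_graph G \<mu> \<longleftrightarrow>
    u \<in> L2 G \<and> (\<exists>c. eq_L2 G u (\<lambda>x. \<Sum>i | \<mu> + complex_of_real (ev i) = 0. c i *s e i x))"
    (is "_ \<longleftrightarrow> _ \<and> (\<exists>c. eq_L2 G u (\<lambda>x. \<Sum>i\<in>?J. c i *s e i x))")
proof (intro iffI conjI)
  assume u: "(u, \<lambda>x. 0) \<in> S_shift_graph G \<mu>"
  then have uV: "u \<in> V0_space G"
    by (rule S_shift_graph_coeff(2)[OF _ L2_zero])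
  then show "u \<in> L2 G"
    by (rule V0_space_L2)
  have coeff: "(\<mu> + complex_of_real (ev i)) * L2_inner G u (e i) = 0" for i
    using S_shift_graph_coeff(1)[OF u L2_zero, of i] by simp
  have "eq_L2 G u (\<lambda>x. \<Sum>i\<in>?J. L2_inner G u (e i) *s e i x)"
  proof (rule V0_eqI[OF uV V0_space_sum[OF V0_space_scale[OF e_V0]]])
    fix j
    have "L2_inner G (\<lambda>x. \<Sum>i\<in>?J. L2_inner G u (e i) *s e i x) (e j)
        = (\<Sum>i\<in>?J. if i = j then L2_inner G u (e i) else 0)"
      by (simp add: L2_inner_sum_left L2_scale e_L2 L2_inner_scale_left orthonormal
          if_distrib[of "\<lambda>z. _ * z"] cong: if_cong)
    also have "\<dots> = L2_inner G u (e j)"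
      using coeff[of j] fin by auto
    finally show "L2_inner G u (e j) = L2_inner G (\<lambda>x. \<Sum>i\<in>?J. L2_inner G u (e i) *s e i x) (e j)"
      by simp
  qed
  then show "\<exists>c. eq_L2 G u (\<lambda>x. \<Sum>i\<in>?J. c i *s e i x)"
    by (rule exI[of _ "\<lambda>i. L2_inner G u (e i)"])
next
  assume "u \<in> L2 G \<and> (\<exists>c. eq_L2 G u (\<lambda>x. \<Sum>i\<in>?J. c i *s e i x))"
  then obtain c where u: "u \<in> L2 G" and c: "eq_L2 G u (\<lambda>x. \<Sum>i\<in>?J. c i *s e i x)"
    by blast
  define v where "v x = (\<Sum>i\<in>?J. c i *s e i x)" for x
  have "(\<lambda>x. c i *s e i x, \<lambda>x. (- \<mu>) *s (c i *s e i x)) \<in> S_graph G" if "i \<in> ?J" for i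
  proof -
    have "complex_of_real (ev i) = - \<mu>"
      using that by (simp add: eq_neg_iff_add_eq_0 add.commute)
    then show ?thesis
      using S_graph_scale[OF eig[of i], of "c i"] by (simp add: vector_smult_assoc mult.commute)
  qed
  then have "(v, \<lambda>x. \<Sum>i\<in>?J. (- \<mu>) *s (c i *s e i x)) \<in> S_graph G"
    unfolding v_def[abs_def] by (rule S_graph_sum)
  then have "(v, \<lambda>x. (- \<mu>) *s v x) \<in> S_graph G"
    by (simp only: v_def vector_scalar_mult_sum)
  moreover have "eq_L2 G v u"
    using c by (auto simp: eq_L2_def v_def)
  moreover from this have "eq_L2 G (\<lambda>x. (- \<mu>) *s v x) (\<lambda>x. (- \<mu>) *s u x)"
    by (auto simp: eq_L2_def)
  ultimately have "(u, \<lambda>x. (- \<mu>) *s u x) \<in> S_graph G"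
    by (rule S_graph_cong[OF _ _ _ u L2_scale[OF u]])
  then show "(u, \<lambda>x. 0) \<in> S_shift_graph G \<mu>"
    by (force simp: S_shift_graph_def eq_L2_def vec_eq_iff)
qed

end

text \<open>The sets \<open>F <+> F\<close> are cofinal among the finite subsets of the sum type, so
  the unordered series over both signs may be summed in pairs.\<close>

lemma L2_has_sum_Plus_diagonal:
  assumes "L2_has_sum G h UNIV u"
  shows "L2_has_sum G (\<lambda>j x. h (Inl j) x + h (Inr j) x) UNIV u"
proof -
  have "filterlim (\<lambda>F :: 'a set. F <+> F) (finite_subsets_at_top UNIV) (finite_subsets_at_top UNIV)"
    unfolding filterlim_iff
  proof (intro allI impI)
    fix P :: "('a + 'a) set \<Rightarrow> bool" assume "eventually P (finite_subsets_at_top UNIV)"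
    then obtain X where X: "finite X" "\<And>Y. finite Y \<Longrightarrow> X \<subseteq> Y \<Longrightarrow> P Y"
      by (auto simp: eventually_finite_subsets_at_top)
    show "\<forall>\<^sub>F F in finite_subsets_at_top UNIV. P (F <+> F)"
      unfolding eventually_finite_subsets_at_top
    proof (intro exI[of _ "Inl -` X \<union> Inr -` X"] conjI allI impI subset_UNIV)
      show "finite (Inl -` X \<union> Inr -` X)"
        using X(1) by (auto intro: finite_vimageI)
      fix F assume F: "finite F \<and> Inl -` X \<union> Inr -` X \<subseteq> F \<and> F \<subseteq> UNIV"
      have "X \<subseteq> F <+> F"
      proof
        fix y assume "y \<in> X"
        then show "y \<in> F <+> F"
          using F by (cases y) auto
      qed
      then show "P (F <+> F)"
        using F by (intro X(2)) auto
    qed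
  qed
  from filterlim_compose[OF L2_has_sum_tendsto[OF assms] this]
  have "((\<lambda>F. L2_norm G (\<lambda>x. (\<Sum>i\<in>F <+> F. h i x) - u x)) \<longlongrightarrow> 0) (finite_subsets_at_top UNIV)" .
  moreover have "(\<Sum>i\<in>F <+> F. h i x) = (\<Sum>j\<in>F. h (Inl j) x + h (Inr j) x)" for F x
    by (cases "finite F") (simp_all add: sum.Plus sum.distrib)
  ultimately show ?thesis
    by (simp add: L2_has_sum_def)
qed

theorem mainTheorem2:
  fixes G :: "(real ^ 3) set"
    and lam :: "nat \<Rightarrow> real"
    and qp qm :: "nat \<Rightarrow> real ^ 3 \<Rightarrow> complex ^ 3"
  assumes dom: "smooth_bounded_domain G"
    and lam_pos: "\<And>j. 0 < lam j"
    and lam_mono: "\<And>j. lam j \<le> lam (Suc j)"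
    and eig_p: "\<And>j. (qp j, \<lambda>x. complex_of_real (lam j) *s qp j x) \<in> S_graph G"
    and eig_m: "\<And>j. (qm j, \<lambda>x. (- complex_of_real (lam j)) *s qm j x) \<in> S_graph G"
    and basis: "orthonormal_basis G (V0_space G) (case_sum qp qm)"
  shows
    "(\<forall>\<mu> :: complex. \<not> S_eigenvalue G \<mu> \<longrightarrow>
        (\<forall>f \<in> V0_space G. \<exists>u.
           (u, f) \<in> S_shift_graph G \<mu> \<and>
           (\<forall>v. (v, f) \<in> S_shift_graph G \<mu> \<longrightarrow> eq_L2 G v u) \<and>
           L2_has_sum G
             (\<lambda>j x. (inverse (\<mu> + complex_of_real (lam j)) * L2_inner G f (qp j)) *s qp j x
                  + (inverse (\<mu> - complex_of_real (lam j)) * L2_inner G f (qm j)) *s qm j x)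
             UNIV u))
     \<and>
     (\<forall>j0.
        (\<forall>f \<in> V0_space G.
           (\<exists>u. (u, f) \<in> S_shift_graph G (complex_of_real (lam j0))) \<longleftrightarrow>
           (\<forall>j. lam j = lam j0 \<longrightarrow> L2_inner G f (qm j) = 0)) \<and>
        finite {j. lam j = lam j0} \<and>
        {u. (u, \<lambda>x. 0) \<in> S_shift_graph G (complex_of_real (lam j0))} =
        {u \<in> L2 G. \<exists>c :: nat \<Rightarrow> complex.
           eq_L2 G u (\<lambda>x. \<Sum>j | lam j = lam j0. c j *s qm j x)})"
proof -
  define e where "e = case_sum qp qm"
  define ev where "ev = case_sum lam (\<lambda>j. - lam j)"
  have e [simp]: "e (Inl j) = qp j" "e (Inr j) = qm j" for j
    by (simp_all add: e_def)
  have ev [simp]: "ev (Inl j) = lam j" "ev (Inr j) = - lam j" for j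
    by (simp_all add: ev_def)
  have mono: "lam i \<le> lam j" if "i \<le> j" for i j
    using that lam_mono by (rule lift_Suc_mono_le[rotated])
  interpret rot_eigenbasis G e ev "lam 0"
  proof
    show "open G" "bounded G" "G \<noteq> {}"
      using dom by (auto simp: smooth_bounded_domain_def)
    show "(e i, \<lambda>x. complex_of_real (ev i) *s e i x) \<in> S_graph G" for i
      using eig_p eig_m by (cases i) simp_all
    show "orthonormal_basis G (V0_space G) e"
      using basis by (simp add: e_def)
    show "lam 0 \<le> \<bar>ev i\<bar>" for i
      using mono[OF le0] lam_pos by (cases i) (auto simp: abs_of_pos)
  qed (rule lam_pos)
  \<comment> \<open>Some \<open>lam N\<close> exceeds M; monotonicity then confines the indices in
    question to j < N in both families.\<close>
  have fin: "finite {i. \<bar>ev i\<bar> \<le> M}" for M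
  proof -
    obtain i where "M < \<bar>ev i\<bar>"
      using eigenvalues_unbounded by blast
    then obtain N where N: "M < lam N"
      using lam_pos by (cases i) (auto simp: abs_of_pos)
    have less_N: "j < N" if "lam j \<le> M" for j
      using that N mono[of N j] by (cases "j < N") auto
    have "i \<in> {..<N} <+> {..<N}" if "\<bar>ev i\<bar> \<le> M" for i
      using that less_N lam_pos by (cases i) (auto simp: abs_of_pos)
    then have "{i. \<bar>ev i\<bar> \<le> M} \<subseteq> {..<N} <+> {..<N}"
      by blast
    then show ?thesis
      by (rule finite_subset) auto
  qed
  show ?thesis
  proof (intro conjI allI impI ballI)
    fix \<mu> f assume \<mu>: "\<not> S_eigenvalue G \<mu>" and f: "f \<in> V0_space G"
    have nz: "\<mu> + complex_of_real (ev i) \<noteq> 0" for i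
    proof
      assume "\<mu> + complex_of_real (ev i) = 0"
      then have \<mu>_eq: "\<mu> = - complex_of_real (ev i)"
        by (simp add: eq_neg_iff_add_eq_0)
      \<comment> \<open>S + \<mu> degenerates when -\<mu> is an eigenvalue, while the hypothesis
        speaks of \<mu>. The pairing of the eigenvalues by sign closes the gap: the partner field of
        index i has eigenvalue -ev i.\<close>
      have "S_eigenvalue G \<mu>"
      proof (cases i)
        case (Inl j)
        then show ?thesis
          using eig_m[of j] basis_nonzero[of "Inr j"] \<mu>_eq by (auto simp: S_eigenvalue_def)
      next
        case (Inr j)
        then show ?thesis
          using eig_p[of j] basis_nonzero[of "Inl j"] \<mu>_eq by (auto simp: S_eigenvalue_def)
      qed
      with \<mu> show False ..
    qed
    obtain c where c: "0 < c"
      "\<forall>i. \<mu> + complex_of_real (ev i) \<noteq> 0 \<longrightarrow> c \<le> cmod (\<mu> + complex_of_real (ev i))"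
      using spectral_gap[OF fin] .
    obtain u where u: "(u, f) \<in> S_shift_graph G \<mu>"
      "L2_has_sum G (\<lambda>i x. (inverse (\<mu> + complex_of_real (ev i)) * L2_inner G f (e i)) *s e i x) UNIV u"
      using S_shift_graph_solution[OF f _ c(1)] nz c(2) by blast
    have "eq_L2 G v u" if v: "(v, f) \<in> S_shift_graph G \<mu>" for v
    proof (rule V0_eqI)
      show "L2_inner G v (e i) = L2_inner G u (e i)" for i
        using S_shift_graph_coeff(1)[OF v V0_space_L2[OF f], of i]
          S_shift_graph_coeff(1)[OF u(1) V0_space_L2[OF f], of i] nz[of i] by simp
    qed (use u(1) v V0_space_L2[OF f] S_shift_graph_coeff(2) in blast)+
    with u(1) L2_has_sum_Plus_diagonal[OF u(2)]
    show "\<exists>u. (u, f) \<in> S_shift_graph G \<mu> \<and>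
           (\<forall>v. (v, f) \<in> S_shift_graph G \<mu> \<longrightarrow> eq_L2 G v u) \<and>
           L2_has_sum G
             (\<lambda>j x. (inverse (\<mu> + complex_of_real (lam j)) * L2_inner G f (qp j)) *s qp j x
                  + (inverse (\<mu> - complex_of_real (lam j)) * L2_inner G f (qm j)) *s qm j x)
             UNIV u"
      by (intro exI[of _ u]) simp
  next
    fix j0
    let ?\<mu> = "complex_of_real (lam j0)"
    \<comment> \<open>Both \<open>lam j0\<close> and \<open>lam j\<close> are positive, so only the
      negative family can resonate.\<close>
    have resonant: "?\<mu> + complex_of_real (ev i) = 0 \<longleftrightarrow> i \<in> Inr ` {j. lam j = lam j0}" for i
    proof (cases i)
      case (Inl j)
      have "lam j0 + lam j \<noteq> 0"
        using lam_pos[of j0] lam_pos[of j] by linarith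
      then show ?thesis
        using Inl by (auto simp flip: of_real_add)
    qed (auto simp flip: of_real_diff)
    show fin_J: "finite {j. lam j = lam j0}"
    proof (rule finite_imageD[of Inr])
      show "finite (Inr ` {j. lam j = lam j0} :: (nat + nat) set)"
        by (rule finite_subset[OF _ fin[of "lam j0"]]) (use lam_pos[of j0] in auto)
    qed simp
    show "(\<exists>u. (u, f) \<in> S_shift_graph G ?\<mu>) \<longleftrightarrow> (\<forall>j. lam j = lam j0 \<longrightarrow> L2_inner G f (qm j) = 0)"
      if f: "f \<in> V0_space G" for f
    proof
      assume "\<exists>u. (u, f) \<in> S_shift_graph G ?\<mu>"
      then obtain u where u: "(u, f) \<in> S_shift_graph G ?\<mu>" ..
      show "\<forall>j. lam j = lam j0 \<longrightarrow> L2_inner G f (qm j) = 0"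
        using S_shift_graph_coeff(1)[OF u V0_space_L2[OF f], of "Inr _"] by simp
    next
      assume orth: "\<forall>j. lam j = lam j0 \<longrightarrow> L2_inner G f (qm j) = 0"
      obtain c where c: "0 < c"
        "\<forall>i. ?\<mu> + complex_of_real (ev i) \<noteq> 0 \<longrightarrow> c \<le> cmod (?\<mu> + complex_of_real (ev i))"
        using spectral_gap[OF fin] .
      have "L2_inner G f (e i) = 0" if "?\<mu> + complex_of_real (ev i) = 0" for i
        using that orth unfolding resonant by auto
      then show "\<exists>u. (u, f) \<in> S_shift_graph G ?\<mu>"
        using S_shift_graph_solution[OF f _ c(1)] c(2) by blast
    qed
    have J: "{i. ?\<mu> + complex_of_real (ev i) = 0} = Inr ` {j. lam j = lam j0}"
      using resonant by blast
    have sum_J: "(\<Sum>i\<in>Inr ` {j. lam j = lam j0}. c i *s e i x) = (\<Sum>j | lam j = lam j0. c (Inr j) *s qm j x)" for c x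
      by (subst sum.reindex) auto
    have "(u, \<lambda>x. 0) \<in> S_shift_graph G ?\<mu> \<longleftrightarrow>
        u \<in> L2 G \<and> (\<exists>c. eq_L2 G u (\<lambda>x. \<Sum>j | lam j = lam j0. c j *s qm j x))" for u
    proof -
      have "(\<exists>c :: nat + nat \<Rightarrow> complex. eq_L2 G u (\<lambda>x. \<Sum>j | lam j = lam j0. c (Inr j) *s qm j x)) \<longleftrightarrow>
          (\<exists>c. eq_L2 G u (\<lambda>x. \<Sum>j | lam j = lam j0. c j *s qm j x))"
      proof (intro iffI; elim exE)
        fix c assume "eq_L2 G u (\<lambda>x. \<Sum>j | lam j = lam j0. c j *s qm j x)"
        then show "\<exists>c :: nat + nat \<Rightarrow> complex. eq_L2 G u (\<lambda>x. \<Sum>j | lam j = lam j0. c (Inr j) *s qm j x)"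
          \<comment> \<open>Only the values at \<open>Inr\<close> enter; those at \<open>Inl\<close>
            are arbitrary.\<close>
          by (intro exI[of _ "case_sum c c"]) simp
      qed (rule exI)
      then show ?thesis
        using S_shift_kernel[of ?\<mu> u] fin_J unfolding J sum_J by simp
    qed
    then show "{u. (u, \<lambda>x. 0) \<in> S_shift_graph G ?\<mu>} =
        {u \<in> L2 G. \<exists>c :: nat \<Rightarrow> complex. eq_L2 G u (\<lambda>x. \<Sum>j | lam j = lam j0. c j *s qm j x)}"
      by blast
  qed
qed

end
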